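(* Let $\mathcal{A}$ be an open set of $\mathbb{R}^5$ and $h:\mathcal{A}\to\mathbb{R}$ a smooth function. Let $I\in\mathcal{A}$ be a point such that $\nabla h(I)\neq 0$. Suppose that: 1. $h$ is four-jet non-degenerate at $I$, i.e. the only $v\in\mathbb{R}^5$ with $h^1_I[v]=0$, $h^2_I[v,v]=0$, $h^3_I[v,v,v]=0$, $h^4_I[v,v,v,v]=0$ is $v=0$; 2. for every $v\in\mathbb{R}^5$, $v\neq 0$, such that $h^1_I[v]=h^2_I[v,v]=h^3_I[v,v,v]=0$, any vector $u\in\mathbb{R}^5$ solving $$\begin{cases} h^1_I[u]=0,\quad h^2_I[u,v]=0,\quad h^2_I[u,u]\,h_I^4[v,v,v,v]=3(h_I^3[v,v,u])^2,\\ 15(h_I^3[v,v,u])^2h_I^3[u,u,v]+h_I^5[v,v,v,v,v](h^2_I[u,u])^2=10\,h^4_I[v,v,v,u]\,h_I^3[u,v,v]\,h_I^2[u,u] \end{cases}$$ satisfies $\mathrm{rk}(u,v)<2$; 3. for every $v\in\mathbb{R}^5$, $v\neq 0$, such that $h^1_I[v]=h^2_I[v,v]=h^3_I[v,v,v]=0$, any couple of vectors $(u,w)$ in $\mathbb{R}^5$ solving $$\begin{cases} h^1_I[u]=0,\quad h^1_I[w]=0,\quad h^2_I[u,v]=0,\quad h^2_I[w,v]=0,\\ \{h_I^4[v,v,v,v]h_I^2[u,u]-6(h_I^3[u,v,v])^2\}\{h^2_I[w,w]h^2_I[u,u]-(h^2_I[u,w])^2\}\\ \quad+12\,h^3_I[u,v,v]h^3_I[v,v,w]h^2_I[u,u]h^2_I[u,w]-6(h_I^3[u,v,v])^2(h_I^2[u,w])^2\\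 \quad-6(h_I^3[v,v,w])^2(h_I^2[u,u])^2=0 \end{cases}$$ satisfies $\mathrm{rk}(u,v,w)<3$; 4. for every $v\in\mathbb{R}^5$, $v\neq 0$, such that $h^1_I[v]=h^2_I[v,v]=0$, any triplet of vectors $(u,w,x)$ in $\mathbb{R}^5$ solving $$h^1_I[u]=h^1_I[w]=h^1_I[x]=0,\qquad h^2_I[u,v]=h^2_I[w,v]=h^2_I[x,v]=0$$ satisfies $\mathrm{rk}(u,w,x,v)<4$. Then $h$ is steep in some neighborhood of $I$.
   Context: Notation: for a smooth function $h$ of $n$ variables, $h_I^k[v^1,\dots,v^k]=\sum_{i_1,\dots,i_k=1}^n \frac{\partial^k h}{\partial I_{i_1}\cdots\partial I_{i_k}}(I)\,v^1_{i_1}\cdots v^k_{i_k}$ for $v^1,\dots,v^k\in\mathbb{R}^n$. $\mathrm{rk}(v_1,\dots,v_m)$ is the rank of the matrix with columns $v_1,\dots,v_m$. Steepness at a point: let $\mathcal{A}\subset\mathbb{R}^n$ be open and $h:\mathcal{A}\to\mathbb{R}$ smooth. $h$ is steep at $I\in\mathcal{A}$ if $\nabla h(I)\neq 0$ and if, for every $m=1,\dots,n-1$, there exist constants $C_m>0$, $\delta_m>0$, $\alpha_m>1$ such that, for all $m$-dimensional affine subspaces $\Lambda_m^I$ through $I$ orthogonal to $\nabla h(I)$, the gradient $\nabla(h|_{\Lambda_m^I})$ of the restriction of $h$ to $\Lambda_m^I$ satisfies $$\max_{0\le\eta\le\xi}\Big(\min_{I'\in\Lambda_m^I,\ \|I-I'\|=\eta}\|\nabla(h|_{\Lambda_m^I})(I')\|\Big)>C_m\xi^{\alpha_m}\qquad\forall\,\xi\in(0,\delta_m].$$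 The $C_m,\delta_m$ are called steepness coefficients and the $\alpha_m$ steepness indices. $h$ is steep in a given domain if it is steep at each point of that domain with uniform indices and coefficients (the same $C_m,\delta_m,\alpha_m$ at all points). *)

theory Defs
  imports "HOL-Analysis.Analysis"
begin

text \<open>
  Iterated partial derivatives, indexed by the list of coordinates; the head of the list is
  differentiated last. A function on an open set \<open>A\<close> is represented by a total function whose
  values outside \<open>A\<close> are irrelevant: on \<open>A\<close> all notions below depend only on germs of \<open>h\<close>
  at points of \<open>A\<close>.
\<close>

fun iter_partial :: "'n::finite list \<Rightarrow> (real ^ 'n \<Rightarrow> real) \<Rightarrow> real ^ 'n \<Rightarrow> real" where
  "iter_partial [] h = h"
| "iter_partial (i # is) h =
     (\<lambda>x. frechet_derivative (iter_partial is h) (at x) (axis i 1))"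

text \<open>
  On an open set, (total) differentiability of the partial derivatives of every order is the same
  as their existence and continuity, i.e. as \<open>h\<close> being of class \<open>C\<^sup>\<infinity>\<close>.
\<close>

definition smooth_on :: "(real ^ 'n::finite) set \<Rightarrow> (real ^ 'n \<Rightarrow> real) \<Rightarrow> bool" where
  "smooth_on A h \<longleftrightarrow> (\<forall>is. \<forall>x\<in>A. iter_partial is h differentiable (at x))"

text \<open>The form \<open>h\<^sub>x\<^sup>k[v\<^sub>1,\<dots>,v\<^sub>k]\<close>; the order \<open>k\<close> is the length of the list of vectors.\<close>

definition hform :: "(real ^ 'n::finite \<Rightarrow> real) \<Rightarrow> real ^ 'n \<Rightarrow> (real ^ 'n) list \<Rightarrow> real" where
  "hform h x vs =
     (\<Sum>is | length is = length vs. iter_partial is h x * (\<Prod>j<length vs. vs ! j $ (is ! j)))"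

definition gradient :: "('a::euclidean_space \<Rightarrow> real) \<Rightarrow> 'a \<Rightarrow> 'a" where
  "gradient h x = (THE g. GDERIV h x :> g)"

text \<open>
  Gradient at \<open>y \<in> L\<close> of the restriction of \<open>h\<close> to an affine subspace \<open>L\<close>: the vector \<open>g\<close> in the
  direction space of \<open>L\<close> that represents the derivative along \<open>L\<close>. (Without the first conjunct
  \<open>g\<close> would be determined only up to vectors normal to \<open>L\<close>.)
\<close>

definition gradient_restrict ::
    "('a::euclidean_space \<Rightarrow> real) \<Rightarrow> 'a set \<Rightarrow> 'a \<Rightarrow> 'a" where
  "gradient_restrict h L y =
     (THE g. g \<in> span ((\<lambda>z. z - y) ` L) \<and> (h has_derivative (\<lambda>v. g \<bullet> v)) (at y within L))"

text \<open>
  Uniform steepness of \<open>h : A \<rightarrow> \<real>\<close> on a set \<open>D\<close>; steepness at a point \<open>x\<close> is the case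
  \<open>D = {x}\<close>. The condition \<open>cball x \<delta> \<subseteq> A\<close> makes explicit that \<open>h\<close> is defined at all points
  \<open>y\<close> over which the minimum is taken. For smooth \<open>h\<close> it also guarantees, by compactness, that
  the infimum and the supremum are attained, so that they are the minimum and the maximum.
\<close>

definition steep_on :: "'a::euclidean_space set \<Rightarrow> ('a \<Rightarrow> real) \<Rightarrow> 'a set \<Rightarrow> bool" where
  "steep_on A h D \<longleftrightarrow>
     (\<forall>x\<in>D. gradient h x \<noteq> 0) \<and>
     (\<forall>m\<in>{1..<DIM('a)}. \<exists>C>0. \<exists>\<delta>>0. \<exists>\<alpha>>1. \<forall>x\<in>D.
        cball x \<delta> \<subseteq> A \<and>
        (\<forall>L. affine L \<and> aff_dim L = int m \<and> x \<in> L \<and> (\<forall>y\<in>L. (y - x) \<bullet> gradient h x = 0) \<longrightarrow>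
          (\<forall>\<xi>\<in>{0<..\<delta>}.
             (SUP \<eta>\<in>{0..\<xi>}. INF y\<in>{y \<in> L. norm (x - y) = \<eta>}. norm (gradient_restrict h L y))
               > C * \<xi> powr \<alpha>)))"

end

theory Submission
  imports Defs
begin

text \<open>
  Suppose the steepness inequality with index 4 fails near \<open>I\<close>. Then there are points
  \<open>x n \<longlonglongrightarrow> I\<close>, subspaces \<open>V n\<close> orthogonal to the gradient at \<open>x n\<close> and scales \<open>\<xi> n \<longlonglongrightarrow> 0\<close> such that
  every sphere of radius \<open>\<eta> \<le> \<xi> n\<close> in \<open>x n + V n\<close> carries a point where the restricted gradient is
  \<open>o((\<xi> n)\<^sup>4)\<close>. Along a subsequence the \<open>V n\<close> converge, and the Hessian restricted to the limit
  subspace is degenerate. The third condition excludes isotropic planes of the Hessian in the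
  orthogonal complement of the gradient, so the kernel is a line, spanned by some \<open>v0\<close>, and the
  Hessian is uniformly nondegenerate on the complements \<open>Y n\<close> of a unit vector \<open>vh n\<close> in \<open>V n\<close>
  (represented below by the orthogonal projections \<open>Q n\<close> onto \<open>Y n\<close>). Solving for the components
  in \<open>Y n\<close> gives a curve \<open>t \<mapsto> x n + t v n + t\<^sup>2 a n\<close> passing within \<open>O((\<xi> n)\<^sup>3)\<close> of the points of small
  gradient. The derivative of \<open>h\<close> along it is therefore \<open>o((\<xi> n)\<^sup>4)\<close> at four separated parameters
  of size \<open>\<xi> n\<close>, so its Taylor coefficients up to order 4 tend to 0. In the limit this gives
  vectors \<open>v0\<close> and \<open>a0\<close> solving the system of the second condition, whence \<open>a0\<close> is parallel to \<open>v0\<close>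
  and the four-jet of \<open>h\<close> vanishes in direction \<open>v0\<close>.
\<close>

subsection \<open>The forms \<open>hform\<close>\<close>

text \<open>The second difference of \<open>f\<close> over a parallelogram with sides along
  \<open>u\<close> and \<open>v\<close> is symmetric in the sides. Two uses of the mean value
  theorem write it as \<open>s * s\<close> times either mixed derivative near \<open>x\<close>, and
  continuity at \<open>x\<close> identifies the limits.\<close>

lemma mixed_directional_derivatives_eq:
  fixes f :: "'a::real_normed_vector \<Rightarrow> real"
  assumes "open A" and "x \<in> A"
    and fu: "\<And>y. y \<in> A \<Longrightarrow> (f has_derivative fu y) (at y)"
    and fuv: "\<And>y. y \<in> A \<Longrightarrow> ((\<lambda>z. fu z u) has_derivative fu' y) (at y)"
    and fvu: "\<And>y. y \<in> A \<Longrightarrow> ((\<lambda>z. fu z v) has_derivative fv' y) (at y)"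
    and cont: "isCont (\<lambda>y. fu' y v) x" "isCont (\<lambda>y. fv' y u) x"
  shows "fu' x v = fv' x u"
proof -
  have line: "((\<lambda>s. g (y + s *\<^sub>R w)) has_real_derivative g' w) (at s)"
    if "(g has_derivative g') (at (y + s *\<^sub>R w))" for g :: "'a \<Rightarrow> real" and g' y w s
  proof -
    have "((\<lambda>s. y + s *\<^sub>R w) has_derivative (\<lambda>h. h *\<^sub>R w)) (at s)"
      by (auto intro!: derivative_eq_intros)
    then have "((\<lambda>s. g (y + s *\<^sub>R w)) has_derivative (\<lambda>h. g' (h *\<^sub>R w))) (at s)"
      by (rule has_derivative_compose) (use that in simp)
    moreover have "(\<lambda>h. g' (h *\<^sub>R w)) = (*) (g' w)"
      using linear_scale[OF has_derivative_linear[OF that]] by (auto simp: mult.commute)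
    ultimately show ?thesis
      by (simp add: has_field_derivative_def)
  qed
  have mvt: "\<exists>a b. \<bar>a\<bar> \<le> s \<and> \<bar>b\<bar> \<le> s \<and>
      f (x + s *\<^sub>R p + s *\<^sub>R q) - f (x + s *\<^sub>R p) - f (x + s *\<^sub>R q) + f x
        = s * s * fp' (x + a *\<^sub>R p + b *\<^sub>R q) q"
    if s: "s > 0" "\<And>a b. \<bar>a\<bar> \<le> s \<Longrightarrow> \<bar>b\<bar> \<le> s \<Longrightarrow> x + a *\<^sub>R p + b *\<^sub>R q \<in> A"
      and fp: "\<And>y. y \<in> A \<Longrightarrow> ((\<lambda>z. fu z p) has_derivative fp' y) (at y)"
    for s p q fp'
  proof -
    \<comment> \<open>The increment of \<open>f\<close> in direction \<open>q\<close>, as a function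
      of the position along \<open>p\<close>; a second mean value theorem then differentiates the
      derivative along \<open>p\<close> in direction \<open>q\<close>.\<close>
    define g where "g = (\<lambda>a. f ((x + s *\<^sub>R q) + a *\<^sub>R p) - f (x + a *\<^sub>R p))"
    have "(g has_real_derivative (fu ((x + s *\<^sub>R q) + a *\<^sub>R p) p - fu (x + a *\<^sub>R p) p)) (at a)"
      if "0 \<le> a" "a \<le> s" for a
      unfolding g_def
      by (intro DERIV_diff line fu)
        (use s(2)[of a s] s(2)[of a 0] that \<open>s > 0\<close> in \<open>auto simp: algebra_simps\<close>)
    from MVT2[OF \<open>s > 0\<close> this] obtain a where a: "0 < a" "a < s"
      "g s - g 0 = (s - 0) * (fu ((x + s *\<^sub>R q) + a *\<^sub>R p) p - fu (x + a *\<^sub>R p) p)"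
      by blast
    define k where "k = (\<lambda>b. fu ((x + a *\<^sub>R p) + b *\<^sub>R q) p)"
    have "(k has_real_derivative fp' ((x + a *\<^sub>R p) + b *\<^sub>R q) q) (at b)"
      if "0 \<le> b" "b \<le> s" for b
      unfolding k_def
      by (rule line[where g = "\<lambda>z. fu z p"], rule fp) (use s(2)[of a b] that a in auto)
    from MVT2[OF \<open>s > 0\<close> this] obtain b where b: "0 < b" "b < s"
      "k s - k 0 = (s - 0) * fp' ((x + a *\<^sub>R p) + b *\<^sub>R q) q"
      by blast
    have "g s - g 0 = s * (k s - k 0)"
      using a(3) by (simp add: k_def algebra_simps)
    also have "\<dots> = s * s * fp' (x + a *\<^sub>R p + b *\<^sub>R q) q"
      using b(3) by simp
    finally have "g s - g 0 = s * s * fp' (x + a *\<^sub>R p + b *\<^sub>R q) q" .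
    then show ?thesis
      using a b by (intro exI[of _ a] exI[of _ b]) (auto simp: g_def algebra_simps)
  qed
  have "\<bar>fu' x v - fv' x u\<bar> < e" if "e > 0" for e
  proof -
    have "eventually (\<lambda>y. dist (fu' y v) (fu' x v) < e / 2) (nhds x)"
      "eventually (\<lambda>y. dist (fv' y u) (fv' x u) < e / 2) (nhds x)"
      using cont[unfolded isCont_def, THEN tendsto_at_iff_tendsto_nhds[THEN iffD1], THEN tendstoD,
          of "e / 2"] \<open>e > 0\<close> by simp_all
    moreover have "eventually (\<lambda>y. y \<in> A) (nhds x)"
      using assms(1,2) by (rule eventually_nhds_in_open)
    ultimately have "eventually (\<lambda>y. y \<in> A \<and> dist (fu' y v) (fu' x v) < e / 2
        \<and> dist (fv' y u) (fv' x u) < e / 2) (nhds x)"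
      by eventually_elim auto
    then obtain r where r: "r > 0" "\<And>y. dist y x < r \<Longrightarrow> y \<in> A \<and> dist (fu' y v) (fu' x v) < e / 2
        \<and> dist (fv' y u) (fv' x u) < e / 2"
      unfolding eventually_nhds_metric by blast
    \<comment> \<open>The factor 2 keeps the parallelogram strictly inside the ball of radius
      \<open>r\<close>; the summand 1 keeps the denominator positive.\<close>
    define s where "s = r / (2 * (norm u + norm v + 1))"
    have "s > 0"
      using r(1) by (simp add: s_def add_nonneg_pos)
    have near: "dist (x + a *\<^sub>R u + b *\<^sub>R v) x < r" if "\<bar>a\<bar> \<le> s" "\<bar>b\<bar> \<le> s" for a b
    proof -
      have "norm (a *\<^sub>R u + b *\<^sub>R v) \<le> \<bar>a\<bar> * norm u + \<bar>b\<bar> * norm v"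
        by (metis norm_scaleR norm_triangle_ineq)
      also have "\<dots> \<le> s * norm u + s * norm v"
        by (intro add_mono mult_right_mono that) auto
      also have "\<dots> \<le> s * (norm u + norm v + 1)"
        using \<open>s > 0\<close> by (simp add: algebra_simps)
      also have "\<dots> = r / 2"
        unfolding s_def using add_nonneg_pos[of "norm u + norm v" 1] by (simp add: field_simps)
      also have "\<dots> < r" using r(1) by simp
      finally show ?thesis by (simp add: dist_norm add.assoc)
    qed
    have near': "dist (x + a *\<^sub>R v + b *\<^sub>R u) x < r" if "\<bar>a\<bar> \<le> s" "\<bar>b\<bar> \<le> s" for a b
      using near[of b a] that by (simp add: algebra_simps)
    obtain a b where ab: "\<bar>a\<bar> \<le> s" "\<bar>b\<bar> \<le> s"
      "f (x + s *\<^sub>R u + s *\<^sub>R v) - f (x + s *\<^sub>R u) - f (x + s *\<^sub>R v) + f x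
        = s * s * fu' (x + a *\<^sub>R u + b *\<^sub>R v) v"
      using mvt[OF \<open>s > 0\<close> _ fuv] near r(2) by blast
    obtain c d where cd: "\<bar>c\<bar> \<le> s" "\<bar>d\<bar> \<le> s"
      "f (x + s *\<^sub>R v + s *\<^sub>R u) - f (x + s *\<^sub>R v) - f (x + s *\<^sub>R u) + f x
        = s * s * fv' (x + c *\<^sub>R v + d *\<^sub>R u) u"
      using mvt[OF \<open>s > 0\<close> _ fvu] near' r(2) by blast
    have "s * s * fu' (x + a *\<^sub>R u + b *\<^sub>R v) v = s * s * fv' (x + c *\<^sub>R v + d *\<^sub>R u) u"
      using ab(3) cd(3) by (simp add: algebra_simps)
    then have "fu' (x + a *\<^sub>R u + b *\<^sub>R v) v = fv' (x + c *\<^sub>R v + d *\<^sub>R u) u"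
      using \<open>s > 0\<close> by simp
    moreover have "dist (fu' (x + a *\<^sub>R u + b *\<^sub>R v) v) (fu' x v) < e / 2"
      using r(2)[OF near[OF ab(1,2)]] by blast
    moreover have "dist (fv' (x + c *\<^sub>R v + d *\<^sub>R u) u) (fv' x u) < e / 2"
      using r(2)[OF near'[OF cd(1,2)]] by blast
    ultimately show ?thesis
      unfolding dist_real_def by linarith
  qed
  then show ?thesis
    by (metis abs_le_zero_iff eq_iff_diff_eq_0 less_irrefl not_le)
qed

lemma hform_Nil: "hform h x [] = h x"
  by (simp add: hform_def)

text \<open>Separates the index of the head vector. It belongs to the partial derivative taken last,
  so the inner sum is the derivative of \<open>iter_partial is h\<close> in direction
  \<open>u\<close>.\<close>

lemma hform_Cons:
  "hform h x (u # vs) = (\<Sum>is | length is = length vs.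
     (\<Sum>i\<in>UNIV. u $ i * iter_partial (i # is) h x) * (\<Prod>j<length vs. vs ! j $ (is ! j)))"
proof -
  have lists: "{is :: 'a list. length is = length (u # vs)}
      = (\<lambda>(is, i). i # is) ` ({is. length is = length vs} \<times> UNIV)"
    by (auto simp: length_Suc_conv image_iff)
  have "hform h x (u # vs) = (\<Sum>(is, i)\<in>{is. length is = length vs} \<times> UNIV.
      iter_partial (i # is) h x * (\<Prod>j<Suc (length vs). (u # vs) ! j $ ((i # is) ! j)))"
    unfolding hform_def lists
    by (subst sum.reindex) (auto simp: inj_on_def case_prod_beta intro!: sum.cong)
  also have "\<dots> = (\<Sum>is | length is = length vs. \<Sum>i\<in>UNIV.
      iter_partial (i # is) h x * (\<Prod>j<Suc (length vs). (u # vs) ! j $ ((i # is) ! j)))"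
    by (simp add: sum.cartesian_product)
  also have "\<dots> = (\<Sum>is | length is = length vs.
     (\<Sum>i\<in>UNIV. u $ i * iter_partial (i # is) h x) * (\<Prod>j<length vs. vs ! j $ (is ! j)))"
    unfolding prod.lessThan_Suc_shift
    by (simp add: sum_distrib_left sum_distrib_right mult_ac del: iter_partial.simps)
  finally show ?thesis .
qed

lemma hform_add: "hform h x ((u + v) # vs) = hform h x (u # vs) + hform h x (v # vs)"
  by (simp add: hform_Cons algebra_simps sum.distrib)

lemma hform_scaleR: "hform h x ((c *\<^sub>R u) # vs) = c * hform h x (u # vs)"
  by (simp add: hform_Cons sum_distrib_left sum_distrib_right mult_ac)

section \<open>Derivatives, symmetry, bounds and Taylor expansion of the forms\<close>

locale smooth_function =
  fixes A :: "(real ^ 'n::finite) set" and h :: "real ^ 'n \<Rightarrow> real"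
  assumes open_dom: "open A" and smooth: "smooth_on A h"
begin

lemma iter_partial_has_derivative:
  assumes "x \<in> A"
  shows "(iter_partial is h has_derivative (\<lambda>u. \<Sum>i\<in>UNIV. u $ i * iter_partial (i # is) h x)) (at x)"
proof -
  let ?D = "frechet_derivative (iter_partial is h) (at x)"
  have D: "(iter_partial is h has_derivative ?D) (at x)"
    using smooth assms by (auto simp: smooth_on_def frechet_derivative_works)
  have "?D u = (\<Sum>i\<in>UNIV. u $ i * iter_partial (i # is) h x)" for u
  proof -
    have "?D u = ?D (\<Sum>i\<in>UNIV. u $ i *\<^sub>R axis i 1)"
      by (metis (mono_tags, lifting) basis_expansion scalar_mult_eq_scaleR sum.cong)
    also have "\<dots> = (\<Sum>i\<in>UNIV. u $ i * iter_partial (i # is) h x)"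
      using has_derivative_linear[OF D] by (simp add: linear_sum linear_scale)
    finally show ?thesis .
  qed
  then show ?thesis
    using D by presburger
qed

lemma isCont_iter_partial: "x \<in> A \<Longrightarrow> isCont (iter_partial is h) x"
  using iter_partial_has_derivative has_derivative_continuous by blast

lemma hform_has_derivative:
  assumes "x \<in> A"
  shows "((\<lambda>y. hform h y vs) has_derivative (\<lambda>u. hform h x (u # vs))) (at x)"
  unfolding hform_Cons unfolding hform_def
  by (intro has_derivative_sum has_derivative_mult_left iter_partial_has_derivative assms)

text \<open>The arguments form a list of functions, so that one statement of joint continuity serves
  forms of every order.\<close>

lemma tendsto_hform:
  assumes "x \<in> A" and "(f \<longlongrightarrow> x) F" and "list_all2 (\<lambda>g l. (g \<longlongrightarrow> l) F) gs vs"
  shows "((\<lambda>t. hform h (f t) (map (\<lambda>g. g t) gs)) \<longlongrightarrow> hform h x vs) F"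
proof -
  have len: "length gs = length vs"
    using assms(3) by (rule list_all2_lengthD)
  have g: "((gs ! j) \<longlongrightarrow> vs ! j) F" if "j < length vs" for j
    using list_all2_nthD2[OF assms(3) that] .
  have "((\<lambda>t. \<Sum>is | length is = length vs. iter_partial is h (f t) *
      (\<Prod>j<length vs. (gs ! j) t $ (is ! j))) \<longlongrightarrow> hform h x vs) F"
    unfolding hform_def
    by (intro tendsto_intros isCont_tendsto_compose[OF isCont_iter_partial] assms g) auto
  then show ?thesis
    by (simp add: hform_def len)
qed

lemma isCont_hform: "x \<in> A \<Longrightarrow> isCont (\<lambda>y. hform h y vs) x"
  using hform_has_derivative has_derivative_continuous by blast

text \<open>Equality of mixed derivatives for \<open>\<lambda>y. hform h y vs\<close>, whose
  directional derivatives are again forms.\<close>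

lemma hform_swap:
  assumes "x \<in> A"
  shows "hform h x (u # v # vs) = hform h x (v # u # vs)"
  by (rule mixed_directional_derivatives_eq[OF open_dom assms,
        where f = "\<lambda>y. hform h y vs" and fu = "\<lambda>y w. hform h y (w # vs)"])
    (auto intro: hform_has_derivative isCont_hform assms)

text \<open>An identity between forms on the open set \<open>A\<close> may be differentiated; this
  carries symmetry of the tail past a new head.\<close>

lemma hform_Cons_cong:
  assumes "\<And>y. y \<in> A \<Longrightarrow> hform h y vs = hform h y ws" and "x \<in> A"
  shows "hform h x (u # vs) = hform h x (u # ws)"
proof -
  have "((\<lambda>y. hform h y vs) has_derivative (\<lambda>u. hform h x (u # ws))) (at x)"
    by (rule has_derivative_transform_within_open[OF hform_has_derivative open_dom])
      (use assms in auto)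
  with hform_has_derivative[OF assms(2)] show ?thesis
    by (metis has_derivative_unique)
qed

lemma hform_insert: "x \<in> A \<Longrightarrow> hform h x (us @ u # vs) = hform h x (u # us @ vs)"
proof (induction us arbitrary: x)
  case (Cons w us)
  then have "hform h x (w # us @ u # vs) = hform h x (w # u # us @ vs)"
    by (intro hform_Cons_cong) auto
  then show ?case
    using Cons.prems by (simp add: hform_swap)
qed simp

lemma hform_mset: "mset vs = mset ws \<Longrightarrow> x \<in> A \<Longrightarrow> hform h x vs = hform h x ws"
proof (induction vs arbitrary: ws x)
  case (Cons v vs)
  then have "v \<in> set ws"
    by (metis list.set_intros(1) set_mset_mset)
  then obtain ws1 ws2 where ws: "ws = ws1 @ v # ws2"
    by (meson split_list)
  then have "mset vs = mset (ws1 @ ws2)"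
    using Cons.prems by simp
  then have "hform h x (v # vs) = hform h x (v # ws1 @ ws2)"
    using Cons by (intro hform_Cons_cong) auto
  then show ?case
    using Cons.prems by (simp add: ws hform_insert)
qed simp

lemma hform_add_at:
  assumes "x \<in> A"
  shows "hform h x (us @ (u + v) # vs) = hform h x (us @ u # vs) + hform h x (us @ v # vs)"
  using assms by (simp add: hform_insert hform_add)

lemma hform_scaleR_at:
  assumes "x \<in> A"
  shows "hform h x (us @ (c *\<^sub>R u) # vs) = c * hform h x (us @ u # vs)"
  using assms by (simp add: hform_insert hform_scaleR)

text \<open>The finitely many partial derivatives of order \<open>k\<close> are continuous, hence
  bounded on \<open>S\<close>, and a component of a vector is at most its norm.\<close>

lemma hform_bound:
  assumes "compact S" "S \<subseteq> A"
  obtains M where "M > 0" "\<And>z vs. z \<in> S \<Longrightarrow> length vs = k \<Longrightarrow> \<bar>hform h z vs\<bar> \<le> M * prod_list (map norm vs)"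
proof -
  have "\<exists>m. \<forall>z\<in>S. norm (iter_partial is h z) \<le> m" for "is"
  proof -
    have "continuous_on S (iter_partial is h)"
      using isCont_iter_partial assms(2) by (auto intro!: continuous_at_imp_continuous_on)
    then have "bounded (iter_partial is h ` S)"
      using assms(1) by (intro compact_imp_bounded compact_continuous_image)
    then show ?thesis by (auto simp: bounded_iff)
  qed
  then obtain m where m: "\<And>is z. z \<in> S \<Longrightarrow> \<bar>iter_partial is h z\<bar> \<le> m is"
    by (metis real_norm_def)
  let ?L = "{is :: 'n list. length is = k}"
  have "\<bar>hform h z vs\<bar> \<le> (1 + (\<Sum>is\<in>?L. \<bar>m is\<bar>)) * prod_list (map norm vs)"
    if z: "z \<in> S" and k: "length vs = k" for z vs
  proof -
    have pl: "prod_list (map norm vs) = (\<Prod>j<k. norm (vs ! j))"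
      using k prod.list_conv_set_nth[of "map norm vs"] by (simp add: atLeast0LessThan)
    have "\<bar>hform h z vs\<bar> \<le> (\<Sum>is\<in>?L. \<bar>iter_partial is h z * (\<Prod>j<k. vs ! j $ (is ! j))\<bar>)"
      unfolding hform_def k by (rule sum_abs)
    also have "\<dots> \<le> (\<Sum>is\<in>?L. \<bar>m is\<bar> * (\<Prod>j<k. norm (vs ! j)))"
      unfolding abs_mult abs_prod
      by (intro sum_mono mult_mono prod_mono conjI component_le_norm_cart)
        (use m[OF z] in \<open>auto intro: order_trans[OF _ abs_ge_self] prod_nonneg\<close>)
    also have "\<dots> \<le> (1 + (\<Sum>is\<in>?L. \<bar>m is\<bar>)) * prod_list (map norm vs)"
      unfolding pl by (simp add: sum_distrib_right[symmetric] mult_right_mono prod_nonneg)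
    finally show ?thesis .
  qed
  moreover have "1 + (\<Sum>is\<in>?L. \<bar>m is\<bar>) > 0"
    by (smt (verit) sum_nonneg abs_ge_zero)
  ultimately show thesis using that by blast
qed

text \<open>Maclaurin's formula of order 5 for
  \<open>\<lambda>s. hform h (x + s *\<^sub>R y) [w]\<close>; each derivative in \<open>s\<close>
  puts one more \<open>y\<close> in front of \<open>w\<close>.\<close>

lemma hform_taylor:
  assumes "\<And>s. 0 \<le> s \<Longrightarrow> s \<le> 1 \<Longrightarrow> x + s *\<^sub>R y \<in> A"
  obtains s where "0 \<le> s" "s \<le> 1"
    "hform h (x + y) [w] = hform h x [w] + hform h x [y, w] + hform h x [y, y, w] / 2
       + hform h x [y, y, y, w] / 6 + hform h x [y, y, y, y, w] / 24
       + hform h (x + s *\<^sub>R y) [y, y, y, y, y, w] / 120"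
proof -
  let ?d = "\<lambda>k s. hform h (x + s *\<^sub>R y) (replicate k y @ [w])"
  have "(?d k has_real_derivative ?d (Suc k) s) (at s)" if "0 \<le> s" "s \<le> 1" for k s
  proof -
    have "((\<lambda>s. x + s *\<^sub>R y) has_derivative (\<lambda>t. t *\<^sub>R y)) (at s)"
      by (auto intro!: derivative_eq_intros)
    from has_derivative_compose[OF this hform_has_derivative[OF assms[OF that]]]
    have "(?d k has_derivative (\<lambda>t. hform h (x + s *\<^sub>R y) ((t *\<^sub>R y) # replicate k y @ [w]))) (at s)" .
    then show ?thesis
      by (simp add: has_field_derivative_def hform_scaleR mult_commute_abs)
  qed
  then have "\<exists>t. 0 < t \<and> t < 1 \<and> ?d 0 1 = (\<Sum>m<5. ?d m 0 / fact m * 1 ^ m) + ?d 5 t / fact 5 * 1 ^ 5"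
    by (intro Maclaurin) auto
  then obtain t where t: "0 < t" "t < 1"
    "?d 0 1 = (\<Sum>m<5. ?d m 0 / fact m * 1 ^ m) + ?d 5 t / fact 5 * 1 ^ 5" by blast
  show thesis
  proof (rule that[of t])
    show "hform h (x + y) [w] = hform h x [w] + hform h x [y, w] + hform h x [y, y, w] / 2
       + hform h x [y, y, y, w] / 6 + hform h x [y, y, y, y, w] / 24
       + hform h (x + t *\<^sub>R y) [y, y, y, y, y, w] / 120"
      using t(3) by (simp add: eval_nat_numeral fact_numeral)
  qed (use t in auto)
qed

lemma gradient_inner:
  assumes "x \<in> A"
  shows "gradient h x \<bullet> w = hform h x [w]"
    and "(h has_derivative (\<lambda>w. gradient h x \<bullet> w)) (at x)"
proof -
  define g :: "real ^ 'n" where "g = (\<chi> i. iter_partial [i] h x)"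
  have g: "hform h x [w] = g \<bullet> w" for w
    by (simp add: hform_Cons inner_vec_def g_def mult.commute)
  have D: "(h has_derivative (\<lambda>w. g \<bullet> w)) (at x)"
    using hform_has_derivative[OF assms, of "[]"] by (simp add: hform_Nil g)
  have "gradient h x = g"
    unfolding gradient_def
  proof (rule the_equality)
    show "GDERIV h x :> g"
      using D by (simp add: gderiv_def inner_commute)
    fix g' assume "GDERIV h x :> g'"
    then have "(\<lambda>w. w \<bullet> g') = (\<lambda>w. g \<bullet> w)"
      using D has_derivative_unique unfolding gderiv_def by blast
    then have "(g' - g) \<bullet> (g' - g) = 0"
      by (metis inner_commute inner_diff_right right_minus_eq)
    then show "g' = g" by simp
  qed
  then show "gradient h x \<bullet> w = hform h x [w]" "(h has_derivative (\<lambda>w. gradient h x \<bullet> w)) (at x)"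
    using g D by auto
qed

end

section \<open>Expansion of the forms along sums of vectors\<close>

context smooth_function
begin

lemma hform_inner: "hform h x (w # vs) = (\<chi> i. hform h x (axis i 1 # vs)) \<bullet> w"
proof -
  have "hform h x (w # vs) = hform h x ((\<Sum>i\<in>UNIV. w $ i *\<^sub>R axis i 1) # vs)"
    by (metis (mono_tags, lifting) basis_expansion scalar_mult_eq_scaleR sum.cong)
  also have "\<dots> = (\<Sum>i\<in>UNIV. w $ i * hform h x (axis i 1 # vs))"
  proof -
    have "linear (\<lambda>u. hform h x (u # vs))"
      by (rule linearI) (simp_all add: hform_add hform_scaleR)
    then show ?thesis by (simp add: linear_sum[of "\<lambda>u. hform h x (u # vs)"] hform_scaleR)
  qed
  finally show ?thesis by (simp add: inner_vec_def mult.commute)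
qed

text \<open>Linearity in each of the first five slots, in a shape that the simplifier can use for
  expansion.\<close>

lemmas hform_linear =
  hform_add hform_scaleR
  hform_add_at[of _ "[p]" for p, simplified] hform_scaleR_at[of _ "[p]" for p, simplified]
  hform_add_at[of _ "[p, q]" for p q, simplified] hform_scaleR_at[of _ "[p, q]" for p q, simplified]
  hform_add_at[of _ "[p, q, r]" for p q r, simplified]
  hform_scaleR_at[of _ "[p, q, r]" for p q r, simplified]
  hform_add_at[of _ "[p, q, r, s]" for p q r s, simplified]
  hform_scaleR_at[of _ "[p, q, r, s]" for p q r s, simplified]

lemma hform_swap_1: "x \<in> A \<Longrightarrow> hform h x (p # u # v # vs) = hform h x (p # v # u # vs)"
  and hform_swap_2: "x \<in> A \<Longrightarrow> hform h x (p # q # u # v # vs) = hform h x (p # q # v # u # vs)"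
  and hform_swap_3: "x \<in> A \<Longrightarrow> hform h x (p # q # r # u # v # vs) = hform h x (p # q # r # v # u # vs)"
  by (auto intro: hform_mset)

text \<open>As permutative rewrite rules these swaps sort the arguments, so that equal monomials are
  recognised.\<close>

lemmas hform_sym = hform_swap hform_swap_1 hform_swap_2 hform_swap_3

lemma hform_4_power:
  assumes "x \<in> A"
  shows "hform h x [t *\<^sub>R v + r, t *\<^sub>R v + r, t *\<^sub>R v + r, w]
    = t ^ 3 * hform h x [v, v, v, w] + 3 * t ^ 2 * hform h x [v, v, r, w]
      + 3 * t * hform h x [v, r, r, w] + hform h x [r, r, r, w]"
  using assms by (simp add: hform_linear hform_sym algebra_simps eval_nat_numeral)

lemma hform_5_power:
  assumes "x \<in> A"
  shows "hform h x [t *\<^sub>R v + r, t *\<^sub>R v + r, t *\<^sub>R v + r, t *\<^sub>R v + r, w]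
    = t ^ 4 * hform h x [v, v, v, v, w] + 4 * t ^ 3 * hform h x [v, v, v, r, w]
      + 6 * t ^ 2 * hform h x [v, v, r, r, w] + 4 * t * hform h x [v, r, r, r, w]
      + hform h x [r, r, r, r, w]"
  using assms by (simp add: hform_linear hform_sym algebra_simps eval_nat_numeral)

text \<open>Here \<open>w\<close> is the velocity at \<open>t\<close> of the curve with coefficients
  \<open>v\<close> and \<open>a\<close>, and \<open>d\<close> is the deviation of \<open>y\<close>
  from it. The last bracket collects what has order at least 5 once \<open>d\<close> has order
  3.\<close>

lemma hform_3_expand:
  assumes "x \<in> A" and "w = v + (2 * t) *\<^sub>R a" and "y = t *\<^sub>R v + t\<^sup>2 *\<^sub>R a + d"
  shows "hform h x [y, y, w] / 2
    = t\<^sup>2 / 2 * hform h x [v, v, v] + 2 * t ^ 3 * hform h x [v, v, a]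
      + 5 / 2 * t ^ 4 * hform h x [v, a, a] + t * hform h x [v, v, d]
      + (t ^ 5 * hform h x [a, a, a] + 2 * t ^ 2 * hform h x [v, d, a]
      + t ^ 2 * hform h x [a, d, w] + hform h x [d, d, w] / 2)"
  using assms by (simp add: hform_linear hform_sym algebra_simps eval_nat_numeral)

text \<open>As \<open>v\<close> is Hessian-orthogonal to \<open>a\<close> and \<open>d\<close>, the
  deviation enters only through \<open>hform h x [a, d]\<close>; for the \<open>a\<close> chosen
  later this cancels the term with \<open>hform h x [v, v, d]\<close> in the cubic
  expansion.\<close>

lemma hform_2_expand:
  assumes "x \<in> A" and "w = v + (2 * t) *\<^sub>R a" and "y = t *\<^sub>R v + t\<^sup>2 *\<^sub>R a + d"
    and "hform h x [v, a] = 0" and "hform h x [v, d] = 0"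
  shows "hform h x [y, w]
    = t * hform h x [v, v] + 2 * t ^ 3 * hform h x [a, a] + 2 * t * hform h x [a, d]"
proof -
  have "hform h x [a, v] = 0" "hform h x [d, v] = 0" "hform h x [d, a] = hform h x [a, d]"
    using assms by (simp_all add: hform_sym)
  then show ?thesis
    using assms by (simp add: hform_linear algebra_simps eval_nat_numeral)
qed

end

subsection \<open>Linear algebra and interpolation\<close>

lemma tendsto_zero_of_mult:
  fixes f g :: "nat \<Rightarrow> real"
  assumes "(\<lambda>n. g n * f n) \<longlonglongrightarrow> 0" and "c > 0" and "\<forall>\<^sub>F n in sequentially. c \<le> \<bar>g n\<bar>"
  shows "f \<longlonglongrightarrow> 0"
proof (rule Lim_null_comparison)
  show "\<forall>\<^sub>F n in sequentially. norm (f n) \<le> \<bar>g n * f n\<bar> / c"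
    using assms(3)
  proof eventually_elim
    case (elim n)
    then have "c * \<bar>f n\<bar> \<le> \<bar>g n * f n\<bar>"
      by (simp add: abs_mult mult_right_mono)
    then show ?case
      using \<open>c > 0\<close> by (simp add: field_simps)
  qed
  show "(\<lambda>n. \<bar>g n * f n\<bar> / c) \<longlonglongrightarrow> 0"
    using tendsto_divide[OF tendsto_rabs_zero[OF assms(1)] tendsto_const[of c]] \<open>c > 0\<close> by simp
qed

lemma tendsto_zero_of_diff_mult:
  fixes f r s :: "nat \<Rightarrow> real"
  assumes "(\<lambda>n. (r n - s n) * f n) \<longlonglongrightarrow> 0" and "(\<lambda>n. \<bar>r n\<bar>) \<longlonglongrightarrow> \<rho>" and "(\<lambda>n. \<bar>s n\<bar>) \<longlonglongrightarrow> \<sigma>" and "\<rho> \<noteq> \<sigma>"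
  shows "f \<longlonglongrightarrow> 0"
proof (rule tendsto_zero_of_mult[OF assms(1)])
  show pos: "\<bar>\<rho> - \<sigma>\<bar> / 2 > 0" using assms(4) by simp
  have "(\<lambda>n. \<bar>\<bar>r n\<bar> - \<bar>s n\<bar>\<bar>) \<longlonglongrightarrow> \<bar>\<rho> - \<sigma>\<bar>"
    by (intro tendsto_intros assms)
  then have "\<forall>\<^sub>F n in sequentially. \<bar>\<rho> - \<sigma>\<bar> / 2 < \<bar>\<bar>r n\<bar> - \<bar>s n\<bar>\<bar>"
    by (rule order_tendstoD) (use pos in simp)
  then show "\<forall>\<^sub>F n in sequentially. \<bar>\<rho> - \<sigma>\<bar> / 2 \<le> \<bar>r n - s n\<bar>"
    by eventually_elim (smt (verit) abs_triangle_ineq3)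
qed

text \<open>Newton's divided differences at the nodes \<open>s j n\<close>. Only the absolute values
  of the nodes converge; their distinct positive limits keep the nodes away from 0 and from each
  other whatever the signs, so each division preserves convergence to 0.\<close>

lemma quartic_coeffs_tendsto_zero:
  fixes p1 p2 p3 p4 :: "nat \<Rightarrow> real" and s :: "nat \<Rightarrow> nat \<Rightarrow> real"
  assumes lim: "\<And>j. j < 4 \<Longrightarrow> (\<lambda>n. \<bar>s j n\<bar>) \<longlonglongrightarrow> \<rho> j"
    and pos: "\<And>j. j < 4 \<Longrightarrow> \<rho> j > 0" and inj: "inj_on \<rho> {..<4}"
    and val: "\<And>j. j < 4 \<Longrightarrow>
      (\<lambda>n. p1 n * s j n + p2 n * s j n ^ 2 + p3 n * s j n ^ 3 + p4 n * s j n ^ 4) \<longlonglongrightarrow> 0"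
  shows "p2 \<longlonglongrightarrow> 0" "p3 \<longlonglongrightarrow> 0" "p4 \<longlonglongrightarrow> 0"
proof -
  have neq: "\<rho> i \<noteq> \<rho> j" if "i < 4" "j < 4" "i \<noteq> j" for i j
    using inj that by (auto simp: inj_on_def)
  \<comment> \<open>The quartic has no constant term, so division by the node leaves a
    cubic.\<close>
  have q: "(\<lambda>n. p1 n + p2 n * s j n + p3 n * s j n ^ 2 + p4 n * s j n ^ 3) \<longlonglongrightarrow> 0" if "j < 4" for j
  proof (rule tendsto_zero_of_diff_mult[where r = "s j" and s = "\<lambda>_. 0" and \<rho> = "\<rho> j" and \<sigma> = 0])
    show "(\<lambda>n. (s j n - 0) * (p1 n + p2 n * s j n + p3 n * s j n ^ 2 + p4 n * s j n ^ 3)) \<longlonglongrightarrow> 0"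
      using val[OF that] by (simp add: algebra_simps eval_nat_numeral)
  qed (use lim[OF that] pos[OF that] in auto)
  have d1: "(\<lambda>n. p2 n + p3 n * (s i n + s j n) + p4 n * (s i n ^ 2 + s i n * s j n + s j n ^ 2)) \<longlonglongrightarrow> 0"
    if "i < 4" "j < 4" "i \<noteq> j" for i j
  proof (rule tendsto_zero_of_diff_mult[where r = "s i" and s = "s j" and \<rho> = "\<rho> i" and \<sigma> = "\<rho> j"])
    show "(\<lambda>n. (s i n - s j n) * (p2 n + p3 n * (s i n + s j n)
        + p4 n * (s i n ^ 2 + s i n * s j n + s j n ^ 2))) \<longlonglongrightarrow> 0"
      using tendsto_diff[OF q[OF that(1)] q[OF that(2)]]
      by (simp add: algebra_simps eval_nat_numeral)
  qed (use lim that neq in auto)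
  have d2: "(\<lambda>n. p3 n + p4 n * (s 0 n + s i n + s j n)) \<longlonglongrightarrow> 0"
    if "i < 4" "j < 4" "i \<noteq> j" "i \<noteq> 0" "j \<noteq> 0" for i j
  proof (rule tendsto_zero_of_diff_mult[where r = "s i" and s = "s j" and \<rho> = "\<rho> i" and \<sigma> = "\<rho> j"])
    show "(\<lambda>n. (s i n - s j n) * (p3 n + p4 n * (s 0 n + s i n + s j n))) \<longlonglongrightarrow> 0"
      using tendsto_diff[OF d1[of 0 i] d1[of 0 j]] that
      by (simp add: algebra_simps eval_nat_numeral)
  qed (use lim that neq in auto)
  show p4: "p4 \<longlonglongrightarrow> 0"
  proof (rule tendsto_zero_of_diff_mult[where r = "s 2" and s = "s 3" and \<rho> = "\<rho> 2" and \<sigma> = "\<rho> 3"])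
    show "(\<lambda>n. (s 2 n - s 3 n) * p4 n) \<longlonglongrightarrow> 0"
      using tendsto_diff[OF d2[of 1 2] d2[of 1 3]] by (simp add: algebra_simps)
  qed (use lim neq in auto)
  \<comment> \<open>The nodes are bounded, so the terms with coefficients already shown to vanish
    can be removed from the lower divided differences.\<close>
  have bd: "(\<lambda>n. p n * s j n) \<longlonglongrightarrow> 0" if "p \<longlonglongrightarrow> 0" "j < 4" for p j
    using tendsto_mult[OF tendsto_rabs_zero[OF that(1)] lim[OF that(2)]]
    by (subst tendsto_rabs_zero_iff[symmetric]) (simp add: abs_mult)
  have b4: "(\<lambda>n. p4 n * s j n) \<longlonglongrightarrow> 0" if "j < 4" for j
    by (rule bd[OF p4 that])
  have b4': "(\<lambda>n. p4 n * s j n * s k n) \<longlonglongrightarrow> 0" if "j < 4" "k < 4" for j k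
    by (rule bd[OF b4[OF that(1)] that(2)])
  show p3: "p3 \<longlonglongrightarrow> 0"
    using tendsto_diff[OF d2[of 1 2] tendsto_add[OF b4[of 0] tendsto_add[OF b4[of 1] b4[of 2]]]]
    by (simp add: algebra_simps)
  have b3: "(\<lambda>n. p3 n * s j n) \<longlonglongrightarrow> 0" if "j < 4" for j
    by (rule bd[OF p3 that])
  show "p2 \<longlonglongrightarrow> 0"
    using tendsto_diff[OF d1[of 0 1] tendsto_add[OF tendsto_add[OF b3[of 0] b3[of 1]]
        tendsto_add[OF b4'[of 0 0] tendsto_add[OF b4'[of 0 1] b4'[of 1 1]]]]]
    by (simp add: algebra_simps power2_eq_square)
qed

text \<open>An injective linear map is bounded below in finite dimension, and convergence on the
  basis is convergence in operator norm; half of the bound survives for large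
  \<open>n\<close>.\<close>

lemma eventually_bounded_below:
  fixes f :: "nat \<Rightarrow> real ^ 'n::finite \<Rightarrow> real ^ 'm::finite" and g :: "real ^ 'n \<Rightarrow> real ^ 'm"
  assumes "\<And>n. linear (f n)" and "linear g" and "inj g"
    and lim: "\<And>i. (\<lambda>n. f n (axis i 1)) \<longlonglongrightarrow> g (axis i 1)"
  obtains c where "c > 0" "\<forall>\<^sub>F n in sequentially. \<forall>y. c * norm y \<le> norm (f n y)"
proof -
  obtain B where B: "B > 0" "\<And>y. B * norm y \<le> norm (g y)"
    using linear_inj_bounded_below_pos[OF \<open>linear g\<close> \<open>inj g\<close>] by blast
  \<comment> \<open>An upper bound for the operator norm of the difference of \<open>f n\<close> and
    \<open>g\<close>.\<close>
  define \<epsilon> where "\<epsilon> = (\<lambda>n. \<Sum>i\<in>UNIV. norm (f n (axis i 1) - g (axis i 1)))"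
  have expand: "k y = (\<Sum>i\<in>UNIV. y $ i *\<^sub>R k (axis i 1))" if "linear k" for k :: "real ^ 'n \<Rightarrow> real ^ 'm" and y
  proof -
    have "k y = k (\<Sum>i\<in>UNIV. y $ i *\<^sub>R axis i 1)"
      by (metis (mono_tags, lifting) basis_expansion scalar_mult_eq_scaleR sum.cong)
    then show ?thesis
      using that by (simp add: linear_sum linear_scale)
  qed
  have err: "norm (f n y - g y) \<le> \<epsilon> n * norm y" for n y
  proof -
    have "f n y - g y = (\<Sum>i\<in>UNIV. y $ i *\<^sub>R (f n (axis i 1) - g (axis i 1)))"
      by (simp add: expand[OF assms(1), of n y] expand[OF assms(2), of y] sum_subtractf scaleR_diff_right)
    also have "norm \<dots> \<le> (\<Sum>i\<in>UNIV. \<bar>y $ i\<bar> * norm (f n (axis i 1) - g (axis i 1)))"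
      by (rule order_trans[OF norm_sum]) simp
    also have "\<dots> \<le> (\<Sum>i\<in>UNIV. norm y * norm (f n (axis i 1) - g (axis i 1)))"
      by (intro sum_mono mult_right_mono component_le_norm_cart) auto
    finally show ?thesis
      by (simp add: \<epsilon>_def sum_distrib_left mult.commute)
  qed
  have "\<epsilon> \<longlonglongrightarrow> (\<Sum>i\<in>(UNIV :: 'n set). norm (g (axis i 1) - g (axis i 1)))"
    unfolding \<epsilon>_def by (intro tendsto_intros lim)
  then have "\<epsilon> \<longlonglongrightarrow> 0" by simp
  then have "\<forall>\<^sub>F n in sequentially. \<epsilon> n < B / 2"
    by (rule order_tendstoD) (use B in simp)
  then have "\<forall>\<^sub>F n in sequentially. \<forall>y. B / 2 * norm y \<le> norm (f n y)"
  proof eventually_elim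
    case (elim n)
    show ?case
    proof
      fix y
      have "norm (f n y - g y) \<le> B / 2 * norm y"
        using err[of n y] elim by (meson less_imp_le mult_right_mono norm_ge_zero order_trans)
      then show "B / 2 * norm y \<le> norm (f n y)"
        using B(2)[of y] norm_triangle_ineq2[of "g y" "f n y"]
        by (simp add: norm_minus_commute)
    qed
  qed
  then show thesis
    using that[of "B / 2"] B(1) by simp
qed

lemma surj_of_bounded_below:
  fixes f :: "'a::euclidean_space \<Rightarrow> 'a"
  assumes "linear f" and "c > 0" and "\<And>y. c * norm y \<le> norm (f y)"
  shows "surj f"
proof (rule linear_injective_imp_surjective[OF assms(1)])
  have "y = 0" if "f y = 0" for y
    using assms(3)[of y] that \<open>c > 0\<close> by (simp add: mult_le_0_iff)
  then show "inj f"
    using linear_injective_0[OF assms(1)] by blast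
qed simp

lemma tendsto_matrix_vector_mult:
  fixes P :: "'b \<Rightarrow> real ^ 'n::finite ^ 'm::finite"
  assumes "(P \<longlongrightarrow> Q) F" "(f \<longlongrightarrow> y) F"
  shows "((\<lambda>t. P t *v f t) \<longlongrightarrow> Q *v y) F"
  unfolding matrix_vector_mult_def
  by (intro vec_tendstoI) (auto intro!: tendsto_intros assms)

text \<open>As matrices, projections onto varying subspaces lie in one finite-dimensional space; the
  norm bound does not depend on \<open>S\<close> and later gives convergent subsequences.\<close>

lemma orthogonal_projection_matrix:
  fixes S :: "(real ^ 'n::finite) set"
  assumes "subspace S"
  obtains P :: "real ^ 'n ^ 'n" where "\<And>y. P *v y \<in> S" "\<And>y. y \<in> S \<Longrightarrow> P *v y = y"
    "\<And>u w. (P *v u) \<bullet> w = u \<bullet> (P *v w)" "norm P \<le> real CARD('n)"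
proof -
  obtain p where p: "\<And>x. p x \<in> S" "\<And>x w. w \<in> S \<Longrightarrow> (x - p x) \<bullet> w = 0"
  proof -
    have "\<exists>y. y \<in> S \<and> (\<forall>w\<in>S. (x - y) \<bullet> w = 0)" for x
    proof -
      have "span S = S"
        using assms by (simp add: span_eq_iff)
      obtain y z where "y \<in> span S" "\<And>w. w \<in> span S \<Longrightarrow> orthogonal z w" "x = y + z"
        using orthogonal_subspace_decomp_exists[of S x] by blast
      then show ?thesis
        using \<open>span S = S\<close> by (intro exI[of _ y]) (auto simp: orthogonal_def)
    qed
    then show thesis using that by metis
  qed
  have uniq: "p x = y" if "y \<in> S" "\<And>w. w \<in> S \<Longrightarrow> (x - y) \<bullet> w = 0" for x y
  proof -
    have "p x - y \<in> S" using p(1) that(1) assms by (simp add: subspace_diff)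
    then have "(x - y) \<bullet> (p x - y) = 0" "(x - p x) \<bullet> (p x - y) = 0"
      using that(2) p(2) by auto
    then have "(p x - y) \<bullet> (p x - y) = 0"
      by (simp add: inner_diff_left)
    then show ?thesis by simp
  qed
  have "linear p"
  proof (rule linearI)
    show "p (x + y) = p x + p y" for x y
      using p(2)[of _ x] p(2)[of _ y] p(1) assms
      by (intro uniq) (auto simp: subspace_add inner_diff_left inner_add_left)
    show "p (c *\<^sub>R x) = c *\<^sub>R p x" for c x
      using p(2)[of _ x] p(1) assms
      by (intro uniq) (auto simp: subspace_scale simp flip: scaleR_diff_right)
  qed
  then have P: "matrix p *v y = p y" for y
    by (simp add: matrix_works)
  have sym: "p u \<bullet> w = u \<bullet> p w" for u w
  proof -
    have "u \<bullet> p w = p u \<bullet> p w" "w \<bullet> p u = p w \<bullet> p u"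
      using p(2)[OF p(1)[of w], of u] p(2)[OF p(1)[of u], of w] by (simp_all add: inner_diff_left)
    then show ?thesis by (metis inner_commute)
  qed
  have contr: "norm (p y) \<le> norm y" for y
  proof -
    have "norm (p y) * norm (p y) = y \<bullet> p y"
      using p(2)[OF p(1)[of y], of y] by (simp add: inner_diff_left norm_eq_sqrt_inner)
    also have "\<dots> \<le> norm y * norm (p y)" by (rule norm_cauchy_schwarz)
    finally show ?thesis
      by (cases "p y = 0") (auto simp: mult_le_cancel_right)
  qed
  \<comment> \<open>By symmetry the rows are the projections of the unit coordinate vectors, hence
    of norm at most 1.\<close>
  have "norm (matrix p) \<le> (\<Sum>i\<in>UNIV. norm (matrix p $ i))"
    unfolding norm_vec_def[of "matrix p"] by (intro L2_set_le_sum) simp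
  also have "\<dots> \<le> (\<Sum>i\<in>(UNIV :: 'n set). 1)"
  proof (rule sum_mono)
    fix i :: 'n
    have "matrix p $ i \<bullet> w = p (axis i 1) \<bullet> w" for w
    proof -
      have "matrix p $ i \<bullet> w = (matrix p *v w) $ i"
        by (simp add: matrix_vector_mul_component)
      also have "\<dots> = axis i 1 \<bullet> p w" by (simp add: P inner_axis')
      finally show ?thesis by (simp add: sym)
    qed
    then have "matrix p $ i = p (axis i 1)"
      by (metis vector_eq_rdot)
    then show "norm (matrix p $ i) \<le> 1"
      using contr[of "axis i 1"] by simp
  qed
  finally have "norm (matrix p) \<le> real CARD('n)" by simp
  then show thesis
    using that[of "matrix p"] p(1) sym uniq by (simp add: P)
qed

subsection \<open>Order of vanishing along a sequence of scales\<close>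

text \<open>The Landau relation \<open>f n = O(\<xi> n ^ k)\<close>; being eventual, it ignores
  finitely many terms.\<close>

definition vanishes_to_order ::
    "(nat \<Rightarrow> real) \<Rightarrow> nat \<Rightarrow> (nat \<Rightarrow> 'a::real_normed_vector) \<Rightarrow> bool" where
  "vanishes_to_order \<xi> k f \<longleftrightarrow> (\<exists>K. \<forall>\<^sub>F n in sequentially. norm (f n) \<le> K * \<xi> n ^ k)"

locale null_scale =
  fixes \<xi> :: "nat \<Rightarrow> real"
  assumes scale_pos: "\<And>n. \<xi> n > 0" and scale_null: "\<xi> \<longlonglongrightarrow> 0"
begin

abbreviation ord :: "nat \<Rightarrow> (nat \<Rightarrow> 'a::real_normed_vector) \<Rightarrow> bool" where
  "ord \<equiv> vanishes_to_order \<xi>"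

lemma ordI: "(\<forall>\<^sub>F n in sequentially. norm (f n) \<le> K * \<xi> n ^ k) \<Longrightarrow> ord k f"
  by (auto simp: vanishes_to_order_def)

lemma ordI_all: "(\<And>n. norm (f n) \<le> K * \<xi> n ^ k) \<Longrightarrow> ord k f"
  by (rule ordI[OF always_eventually]) blast

lemma ordE:
  assumes "ord k f"
  obtains K where "K \<ge> 0" "\<forall>\<^sub>F n in sequentially. norm (f n) \<le> K * \<xi> n ^ k"
proof -
  obtain K where K: "\<forall>\<^sub>F n in sequentially. norm (f n) \<le> K * \<xi> n ^ k"
    using assms by (auto simp: vanishes_to_order_def)
  have "\<forall>\<^sub>F n in sequentially. norm (f n) \<le> \<bar>K\<bar> * \<xi> n ^ k"
    using K
  proof eventually_elim
    case (elim n)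
    then show ?case
      using scale_pos[of n] mult_right_mono[OF abs_ge_self[of K], of "\<xi> n ^ k"]
      by (meson less_imp_le order_trans zero_le_power)
  qed
  then show thesis using that[of "\<bar>K\<bar>"] by simp
qed

lemma ord_mono:
  assumes "ord i f" and "k \<le> i"
  shows "ord k f"
proof -
  obtain K where K: "K \<ge> 0" "\<forall>\<^sub>F n in sequentially. norm (f n) \<le> K * \<xi> n ^ i"
    using ordE[OF assms(1)] .
  have "\<forall>\<^sub>F n in sequentially. \<xi> n < 1"
    using scale_null by (rule order_tendstoD) simp
  with K(2) have "\<forall>\<^sub>F n in sequentially. norm (f n) \<le> K * \<xi> n ^ k"
  proof eventually_elim
    case (elim n)
    have "K * \<xi> n ^ i \<le> K * \<xi> n ^ k"
      using elim(2) scale_pos[of n] assms(2) K(1) by (intro mult_left_mono power_decreasing) auto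
    then show ?case using elim(1) by linarith
  qed
  then show ?thesis by (rule ordI)
qed

lemma ord_add:
  assumes "ord k f" and "ord k g"
  shows "ord k (\<lambda>n. f n + g n)"
proof -
  obtain K L where "\<forall>\<^sub>F n in sequentially. norm (f n) \<le> K * \<xi> n ^ k"
    "\<forall>\<^sub>F n in sequentially. norm (g n) \<le> L * \<xi> n ^ k"
    using assms by (metis ordE)
  then have "\<forall>\<^sub>F n in sequentially. norm (f n + g n) \<le> (K + L) * \<xi> n ^ k"
    by eventually_elim (auto simp: distrib_right intro: order_trans[OF norm_triangle_ineq add_mono])
  then show ?thesis by (rule ordI)
qed

lemma ord_minus: "ord k f \<Longrightarrow> ord k (\<lambda>n. - f n)"
  by (simp add: vanishes_to_order_def)

lemma ord_diff: "ord k f \<Longrightarrow> ord k g \<Longrightarrow> ord k (\<lambda>n. f n - g n)"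
  using ord_add[OF _ ord_minus, of k f g] by simp

lemma ord_scaleR:
  assumes "ord i f" and "ord j g" and "k \<le> i + j"
  shows "ord k (\<lambda>n. f n *\<^sub>R g n)"
proof -
  obtain K where K: "K \<ge> 0" "\<forall>\<^sub>F n in sequentially. norm (f n) \<le> K * \<xi> n ^ i"
    using ordE[OF assms(1)] .
  obtain L where L: "L \<ge> 0" "\<forall>\<^sub>F n in sequentially. norm (g n) \<le> L * \<xi> n ^ j"
    using ordE[OF assms(2)] .
  have "\<forall>\<^sub>F n in sequentially. norm (f n *\<^sub>R g n) \<le> (K * L) * \<xi> n ^ (i + j)"
    using K(2) L(2)
  proof eventually_elim
    case (elim n)
    have "norm (f n *\<^sub>R g n) \<le> (K * \<xi> n ^ i) * (L * \<xi> n ^ j)"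
      unfolding norm_scaleR using elim K(1) scale_pos[of n]
      by (intro mult_mono) auto
    then show ?case by (simp add: power_add mult_ac)
  qed
  then have "ord (i + j) (\<lambda>n. f n *\<^sub>R g n)" by (rule ordI)
  then show ?thesis using assms(3) by (rule ord_mono)
qed

lemma ord_mult:
  fixes f g :: "nat \<Rightarrow> real"
  shows "ord i f \<Longrightarrow> ord j g \<Longrightarrow> k \<le> i + j \<Longrightarrow> ord k (\<lambda>n. f n * g n)"
  using ord_scaleR[of i f j g k] by simp

lemma ord_const: "ord 0 (\<lambda>n. c)"
  by (rule ordI_all[of _ "norm c"]) simp

lemma ord_cmult:
  fixes f :: "nat \<Rightarrow> real"
  shows "ord k f \<Longrightarrow> ord k (\<lambda>n. c * f n)"
  by (rule ord_mult[OF ord_const]) auto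

lemma ord_power:
  fixes f :: "nat \<Rightarrow> real"
  assumes "ord 1 f"
  shows "ord k (\<lambda>n. f n ^ k)"
proof (induction k)
  case (Suc k)
  then show ?case using ord_mult[OF assms Suc] by simp
qed (simp add: ord_const)

lemma ord_tendsto: "f \<longlonglongrightarrow> l \<Longrightarrow> ord 0 f"
proof -
  assume "f \<longlonglongrightarrow> l"
  then have "(\<lambda>n. norm (f n)) \<longlonglongrightarrow> norm l" by (rule tendsto_norm)
  then have "\<forall>\<^sub>F n in sequentially. norm (f n) < norm l + 1"
    by (rule order_tendstoD) simp
  then have "\<forall>\<^sub>F n in sequentially. norm (f n) \<le> (norm l + 1) * \<xi> n ^ 0"
    by eventually_elim simp
  then show ?thesis by (rule ordI)
qed

lemma ord_self: "ord 1 \<xi>"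
  by (rule ordI_all[of _ 1]) (simp add: scale_pos less_imp_le)

text \<open>One spare order turns a bound into convergence to 0.\<close>

lemma ord_divide_tendsto:
  fixes f :: "nat \<Rightarrow> real"
  assumes "ord (Suc k) f"
  shows "(\<lambda>n. f n / \<xi> n ^ k) \<longlonglongrightarrow> 0"
proof -
  obtain K where K: "\<forall>\<^sub>F n in sequentially. norm (f n) \<le> K * \<xi> n ^ Suc k"
    using assms by (rule ordE)
  show ?thesis
  proof (rule Lim_null_comparison)
    show "\<forall>\<^sub>F n in sequentially. norm (f n / \<xi> n ^ k) \<le> K * \<xi> n"
      using K
    proof eventually_elim
      case (elim n)
      then show ?case
        using scale_pos[of n] by (simp add: divide_simps mult_ac)
    qed
    show "(\<lambda>n. K * \<xi> n) \<longlonglongrightarrow> 0"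
      using tendsto_mult[OF tendsto_const scale_null] by simp
  qed
qed

lemma ord_comparison:
  assumes "ord k g" and "c > 0" and "\<And>n. c * norm (f n) \<le> norm (g n)"
  shows "ord k f"
proof -
  obtain K where K: "\<forall>\<^sub>F n in sequentially. norm (g n) \<le> K * \<xi> n ^ k"
    using ordE[OF assms(1)] .
  have "\<forall>\<^sub>F n in sequentially. norm (f n) \<le> (K / c) * \<xi> n ^ k"
    using K
  proof eventually_elim
    case (elim n)
    then have "c * norm (f n) \<le> K * \<xi> n ^ k" using assms(3)[of n] by linarith
    then show ?case using \<open>c > 0\<close> by (simp add: field_simps)
  qed
  then show ?thesis by (rule ordI)
qed

end

subsection \<open>Reduction to a curve\<close>

text \<open>The data of a failing sequence after passage to a subsequence. The unit vector
  \<open>vh n\<close> points to a point of small gradient at radius \<open>\<xi> n\<close>, and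
  \<open>Q n\<close> projects onto the complement of \<open>vh n\<close> in \<open>V n\<close>; both
  converge. By \<open>near_center\<close> all points considered stay in one compact ball, which
  makes bounds uniform in \<open>n\<close>.\<close>

locale degenerating = smooth_function A h + null_scale \<xi>
  for A :: "(real ^ 'n::finite) set" and h \<xi> +
  fixes I :: "real ^ 'n" and R :: real and x :: "nat \<Rightarrow> real ^ 'n" and e :: "nat \<Rightarrow> real"
    and V :: "nat \<Rightarrow> (real ^ 'n) set" and vh :: "nat \<Rightarrow> real ^ 'n" and v0 :: "real ^ 'n"
    and Q :: "nat \<Rightarrow> real ^ 'n ^ 'n" and Q0 :: "real ^ 'n ^ 'n"
  assumes ball_dom: "cball I R \<subseteq> A"
    and near_center: "\<And>n. norm (x n - I) + \<xi> n \<le> R"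
    and x_lim: "x \<longlonglongrightarrow> I"
    and e_small: "(\<lambda>n. e n / \<xi> n ^ 4) \<longlonglongrightarrow> 0"
    and V_orthogonal: "\<And>n w. w \<in> V n \<Longrightarrow> hform h (x n) [w] = 0"
    and V_subspace: "\<And>n. subspace (V n)"
    and V_decomp: "\<And>n y. y \<in> V n \<Longrightarrow> y = (vh n \<bullet> y) *\<^sub>R vh n + Q n *v y"
    and vh_V: "\<And>n. vh n \<in> V n" and Q_V: "\<And>n y. Q n *v y \<in> V n"
    and vh_norm: "\<And>n. norm (vh n) = 1" and vh_lim: "vh \<longlonglongrightarrow> v0"
    and Q_idem: "\<And>n y. Q n *v (Q n *v y) = Q n *v y"
    and Q_sym: "\<And>n y w. (Q n *v y) \<bullet> w = y \<bullet> (Q n *v w)"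
    and Q_vh: "\<And>n. Q n *v vh n = 0" and Q_lim: "Q \<longlonglongrightarrow> Q0"
    and small_gradient_vh: "\<And>n w. w \<in> V n \<Longrightarrow> \<bar>hform h (x n + \<xi> n *\<^sub>R vh n) [w]\<bar> \<le> e n * norm w"
    and small_gradient: "\<And>n \<eta>. 0 \<le> \<eta> \<Longrightarrow> \<eta> \<le> \<xi> n \<Longrightarrow>
      \<exists>y\<in>V n. norm y = \<eta> \<and> (\<forall>w\<in>V n. \<bar>hform h (x n + y) [w]\<bar> \<le> e n * norm w)"
    and no_isotropic_plane: "\<And>u v. hform h I [u] = 0 \<Longrightarrow> hform h I [v] = 0 \<Longrightarrow> hform h I [u, u] = 0 \<Longrightarrow>
      hform h I [u, v] = 0 \<Longrightarrow> hform h I [v, v] = 0 \<Longrightarrow> u \<bullet> v = 0 \<Longrightarrow> v \<noteq> 0 \<Longrightarrow> u = 0"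
begin

lemma x_plus_dom: "norm y \<le> \<xi> n \<Longrightarrow> x n + y \<in> cball I R"
proof -
  assume "norm y \<le> \<xi> n"
  moreover have "dist I (x n + y) = norm ((x n - I) + y)"
    by (metis add_diff_eq add.commute dist_commute dist_norm)
  ultimately show ?thesis
    using near_center[of n] norm_triangle_ineq[of "x n - I" y] by simp
qed

lemma x_ball: "x n \<in> cball I R"
  using x_plus_dom[of 0 n] scale_pos[of n] by simp

lemma x_dom [simp]: "x n \<in> A"
  using x_ball ball_dom by blast

lemma I_dom [simp]: "I \<in> A"
proof -
  have "R \<ge> 0" using near_center[of 0] scale_pos[of 0] norm_ge_zero[of "x 0 - I"] by linarith
  then show ?thesis using ball_dom by (meson centre_in_cball subsetD)
qed

section \<open>Orders of the forms and of the Taylor remainder\<close>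

lemma ord_prod_list_norm:
  "list_all2 (\<lambda>f k. ord k f) fs ks \<Longrightarrow> ord (sum_list ks) (\<lambda>n. prod_list (map (\<lambda>f. norm (f n)) fs))"
proof (induction rule: list_all2_induct)
  case Nil
  then show ?case by (simp add: ord_const)
next
  case (Cons f fs k ks)
  have "ord k (\<lambda>n. norm (f n))"
    using Cons(1) by (simp add: vanishes_to_order_def)
  from ord_mult[OF this Cons(3)] show ?case by simp
qed

text \<open>The bound of \<open>hform_bound\<close> on \<open>cball I R\<close> is uniform in
  \<open>n\<close>, so the orders of the arguments add up.\<close>

lemma ord_hform:
  assumes "list_all2 (\<lambda>f k. ord k f) fs ks" and "k \<le> sum_list ks"
  shows "ord k (\<lambda>n. hform h (x n) (map (\<lambda>f. f n) fs))"
proof -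
  obtain M where M: "M > 0"
    "\<And>z vs. z \<in> cball I R \<Longrightarrow> length vs = length fs \<Longrightarrow> \<bar>hform h z vs\<bar> \<le> M * prod_list (map norm vs)"
    by (rule hform_bound[OF compact_cball ball_dom, where k = "length fs"]) (rule that, blast+)
  have P: "ord k (\<lambda>n. prod_list (map (\<lambda>f. norm (f n)) fs))"
    by (rule ord_mono[OF ord_prod_list_norm[OF assms(1)] assms(2)])
  have le: "1 / M * norm (hform h (x n) (map (\<lambda>f. f n) fs)) \<le> norm (prod_list (map (\<lambda>f. norm (f n)) fs))"
    for n
  proof -
    have "\<bar>hform h (x n) (map (\<lambda>f. f n) fs)\<bar> \<le> M * prod_list (map (\<lambda>f. norm (f n)) fs)"
      using M(2)[OF x_ball, of "map (\<lambda>f. f n) fs" n] by (simp add: o_def)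
    also have "\<dots> \<le> M * norm (prod_list (map (\<lambda>f. norm (f n)) fs))"
      using M(1) by (intro mult_left_mono) auto
    finally show ?thesis using M(1) by (simp add: pos_divide_le_eq mult.commute[of M])
  qed
  show ?thesis
    by (rule ord_comparison[OF P _ le]) (use M(1) in simp)
qed

lemma ord_hform_3: "ord i f \<Longrightarrow> ord j g \<Longrightarrow> ord k p \<Longrightarrow> m \<le> i + j + k \<Longrightarrow>
    ord m (\<lambda>n. hform h (x n) [f n, g n, p n])"
  using ord_hform[of "[f, g, p]" "[i, j, k]" m] by simp

lemma ord_hform_4: "ord i f \<Longrightarrow> ord j g \<Longrightarrow> ord k p \<Longrightarrow> ord l q \<Longrightarrow> m \<le> i + j + k + l \<Longrightarrow>
    ord m (\<lambda>n. hform h (x n) [f n, g n, p n, q n])"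
  using ord_hform[of "[f, g, p, q]" "[i, j, k, l]" m] by simp

lemma ord_hform_5: "ord i f \<Longrightarrow> ord j g \<Longrightarrow> ord k p \<Longrightarrow> ord l q \<Longrightarrow> ord i' r \<Longrightarrow>
    m \<le> i + j + k + l + i' \<Longrightarrow> ord m (\<lambda>n. hform h (x n) [f n, g n, p n, q n, r n])"
  using ord_hform[of "[f, g, p, q, r]" "[i, j, k, l, i']" m] by simp

text \<open>The remainder of \<open>hform_taylor\<close> is evaluated on a segment inside
  \<open>cball I R\<close> and contains five factors \<open>y n\<close>.\<close>

lemma ord_taylor:
  assumes y: "\<And>n. norm (y n) \<le> \<xi> n" and w: "ord 0 w"
  shows "ord 5 (\<lambda>n. hform h (x n + y n) [w n] - (hform h (x n) [w n] + hform h (x n) [y n, w n]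
    + hform h (x n) [y n, y n, w n] / 2 + hform h (x n) [y n, y n, y n, w n] / 6
    + hform h (x n) [y n, y n, y n, y n, w n] / 24))" (is "ord 5 (\<lambda>n. ?r n)")
proof -
  obtain M where M: "M > 0"
    "\<And>z vs. z \<in> cball I R \<Longrightarrow> length vs = 6 \<Longrightarrow> \<bar>hform h z vs\<bar> \<le> M * prod_list (map norm vs)"
    by (rule hform_bound[OF compact_cball ball_dom, where k = 6]) (rule that, blast+)
  have r: "1 / M * norm (?r n) \<le> norm (\<xi> n ^ 5 *\<^sub>R w n)" for n
  proof -
    have seg: "x n + s *\<^sub>R y n \<in> cball I R" if "0 \<le> s" "s \<le> 1" for s
      using that y[of n] mult_mono[of s 1 "norm (y n)" "\<xi> n"] by (intro x_plus_dom) simp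
    have seg_dom: "x n + s *\<^sub>R y n \<in> A" if "0 \<le> s" "s \<le> 1" for s
      using seg[OF that] ball_dom by blast
    obtain s where s: "0 \<le> s" "s \<le> 1"
      "?r n = hform h (x n + s *\<^sub>R y n) [y n, y n, y n, y n, y n, w n] / 120"
    proof (rule hform_taylor[OF seg_dom, where w = "w n"])
      fix s
      assume "0 \<le> s" "s \<le> 1" and
        "hform h (x n + y n) [w n] = hform h (x n) [w n] + hform h (x n) [y n, w n]
          + hform h (x n) [y n, y n, w n] / 2 + hform h (x n) [y n, y n, y n, w n] / 6
          + hform h (x n) [y n, y n, y n, y n, w n] / 24
          + hform h (x n + s *\<^sub>R y n) [y n, y n, y n, y n, y n, w n] / 120"
      then show thesis by (intro that[of s]) linarith+
    qed
    have "\<bar>?r n\<bar> \<le> \<bar>hform h (x n + s *\<^sub>R y n) [y n, y n, y n, y n, y n, w n]\<bar>"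
      unfolding s(3) by simp
    also have "\<dots> \<le> M * prod_list (map norm [y n, y n, y n, y n, y n, w n])"
      using s by (intro M seg) auto
    also have "\<dots> = M * (norm (y n) ^ 5 * norm (w n))"
      by (simp add: eval_nat_numeral)
    also have "\<dots> \<le> M * (\<xi> n ^ 5 * norm (w n))"
      using M(1) y by (intro mult_left_mono mult_right_mono power_mono) auto
    finally show ?thesis
      using M(1) scale_pos[of n] by (simp add: field_simps)
  qed
  have "ord 5 (\<lambda>n. \<xi> n ^ 5 *\<^sub>R w n)"
    by (rule ord_scaleR[OF ord_power[OF ord_self] w]) simp
  from ord_comparison[OF this _ r] show ?thesis using M(1) by simp
qed

lemma ord_vh: "ord 0 vh"
  by (rule ord_tendsto[OF vh_lim])

lemma ord_e: "ord 4 e"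
proof -
  have "ord 4 (\<lambda>n. e n / \<xi> n ^ 4 * \<xi> n ^ 4)"
    by (rule ord_mult[OF ord_tendsto[OF e_small] ord_power[OF ord_self]]) simp
  moreover have "e n / \<xi> n ^ 4 * \<xi> n ^ 4 = e n" for n
    using scale_pos[of n] by simp
  ultimately show ?thesis by simp
qed

lemma e_nonneg: "e n \<ge> 0"
  using small_gradient_vh[OF vh_V, of n] by (simp add: vh_norm)

lemma ord_small_gradient:
  assumes "\<And>n w. w \<in> V n \<Longrightarrow> \<bar>hform h (x n + y n) [w]\<bar> \<le> e n * norm w"
    and "\<And>n. w n \<in> V n" and "ord 0 w"
  shows "ord 4 (\<lambda>n. hform h (x n + y n) [w n])"
proof (rule ord_comparison[where c = 1])
  show "ord 4 (\<lambda>n. e n *\<^sub>R w n)"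
    by (rule ord_scaleR[OF ord_e assms(3)]) simp
  show "1 * norm (hform h (x n + y n) [w n]) \<le> norm (e n *\<^sub>R w n)" for n
    using assms(1)[OF assms(2), of n] e_nonneg[of n] by simp
qed simp

text \<open>At \<open>\<xi> n *\<^sub>R vh n\<close> the gradient is small and the first-order form
  vanishes on \<open>V n\<close>. Taylor's formula thus leaves
  \<open>\<xi> n * hform h (x n) [vh n, w n]\<close> of order 2, and division by
  \<open>\<xi> n\<close> gives the claim.\<close>

lemma hform_vh_tendsto_0:
  assumes w: "\<And>n. w n \<in> V n" and ord_w: "ord 0 w"
  shows "(\<lambda>n. hform h (x n) [vh n, w n]) \<longlonglongrightarrow> 0"
proof -
  define y where "y = (\<lambda>n. \<xi> n *\<^sub>R vh n)"
  have y: "ord 1 y"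
    unfolding y_def by (rule ord_scaleR[OF ord_self ord_vh]) simp
  have 1: "ord 2 (\<lambda>n. hform h (x n + y n) [w n])"
    by (rule ord_mono[OF ord_small_gradient[OF _ w ord_w]]) (auto simp: y_def small_gradient_vh)
  have 2: "ord 2 (\<lambda>n. hform h (x n + y n) [w n] - (hform h (x n) [w n] + hform h (x n) [y n, w n]
    + hform h (x n) [y n, y n, w n] / 2 + hform h (x n) [y n, y n, y n, w n] / 6
    + hform h (x n) [y n, y n, y n, y n, w n] / 24))"
    by (rule ord_mono[OF ord_taylor[OF _ ord_w]])
      (use scale_pos in \<open>auto simp: y_def vh_norm less_imp_le\<close>)
  have 3: "ord 2 (\<lambda>n. 1 / 2 * hform h (x n) [y n, y n, w n])"
    "ord 2 (\<lambda>n. 1 / 6 * hform h (x n) [y n, y n, y n, w n])"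
    "ord 2 (\<lambda>n. 1 / 24 * hform h (x n) [y n, y n, y n, y n, w n])"
    by (rule ord_cmult, rule ord_hform_3[OF y y ord_w] ord_hform_4[OF y y y ord_w]
        ord_hform_5[OF y y y y ord_w], simp)+
  have "ord 2 (\<lambda>n. \<xi> n * hform h (x n) [vh n, w n])"
    using ord_diff[OF ord_diff[OF ord_diff[OF ord_diff[OF 1 2] 3(1)] 3(2)] 3(3)] V_orthogonal[OF w]
    by (simp add: y_def hform_scaleR)
  then have "(\<lambda>n. \<xi> n * hform h (x n) [vh n, w n] / \<xi> n ^ 1) \<longlonglongrightarrow> 0"
    by (intro ord_divide_tendsto) (simp add: numeral_2_eq_2)
  moreover have "\<xi> n \<noteq> 0" for n using scale_pos[of n] by simp
  ultimately show ?thesis by simp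
qed

lemma tendsto_hform_seq:
  assumes "list_all2 (\<lambda>g l. g \<longlonglongrightarrow> l) gs vs"
  shows "(\<lambda>n. hform h (x n) (map (\<lambda>g. g n) gs)) \<longlonglongrightarrow> hform h I vs"
  using tendsto_hform[OF I_dom x_lim assms] .

lemma Q_tendsto: "f \<longlonglongrightarrow> y \<Longrightarrow> (\<lambda>n. Q n *v f n) \<longlonglongrightarrow> Q0 *v y"
  by (rule tendsto_matrix_vector_mult[OF Q_lim])

lemma Q0_idem: "Q0 *v (Q0 *v y) = Q0 *v y"
proof -
  have "(\<lambda>n. Q n *v (Q n *v y)) \<longlonglongrightarrow> Q0 *v (Q0 *v y)" "(\<lambda>n. Q n *v y) \<longlonglongrightarrow> Q0 *v y"
    by (intro Q_tendsto tendsto_const)+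
  then show ?thesis by (simp add: Q_idem LIMSEQ_unique)
qed

lemma Q0_sym: "(Q0 *v y) \<bullet> w = y \<bullet> (Q0 *v w)"
proof -
  have "(\<lambda>n. (Q n *v y) \<bullet> w) \<longlonglongrightarrow> (Q0 *v y) \<bullet> w" "(\<lambda>n. y \<bullet> (Q n *v w)) \<longlonglongrightarrow> y \<bullet> (Q0 *v w)"
    by (intro tendsto_intros Q_tendsto tendsto_const)+
  then show ?thesis by (simp add: Q_sym LIMSEQ_unique)
qed

lemma Q0_v0: "Q0 *v v0 = 0"
  using LIMSEQ_unique[OF Q_tendsto[OF vh_lim]] by (simp add: Q_vh)

lemma v0_norm: "norm v0 = 1"
  using LIMSEQ_unique[OF tendsto_norm[OF vh_lim]] by (simp add: vh_norm)

text \<open>Together \<open>v0\<close> and the range of \<open>Q0\<close> span the limit of the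
  spaces \<open>V n\<close>; the restriction of the limiting Hessian to it has \<open>v0\<close> in
  its kernel.\<close>

lemma limit_kernel:
  shows "hform h I [v0] = 0" "hform h I [Q0 *v w] = 0"
    and "hform h I [v0, v0] = 0" "hform h I [v0, Q0 *v w] = 0"
proof -
  have Qw: "(\<lambda>n. Q n *v w) \<longlonglongrightarrow> Q0 *v w" by (intro Q_tendsto tendsto_const)
  show "hform h I [v0] = 0"
    using LIMSEQ_unique[OF tendsto_hform_seq[of "[vh]" "[v0]"], of 0] vh_lim V_orthogonal[OF vh_V]
    by simp
  show "hform h I [Q0 *v w] = 0"
    using LIMSEQ_unique[OF tendsto_hform_seq[of "[\<lambda>n. Q n *v w]" "[Q0 *v w]"], of 0]
      Qw V_orthogonal[OF Q_V]
    by simp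
  show "hform h I [v0, v0] = 0"
    using LIMSEQ_unique[OF tendsto_hform_seq[of "[vh, vh]" "[v0, v0]"], of 0] vh_lim
      hform_vh_tendsto_0[OF vh_V ord_vh]
    by simp
  show "hform h I [v0, Q0 *v w] = 0"
    using LIMSEQ_unique[OF tendsto_hform_seq[of "[vh, \<lambda>n. Q n *v w]" "[v0, Q0 *v w]"], of 0]
      vh_lim Qw hform_vh_tendsto_0[OF Q_V ord_tendsto[OF Qw]]
    by simp
qed

text \<open>The vector representing a form in its first argument; \<open>dvec z [u]\<close> is the
  Hessian at \<open>z\<close> applied to \<open>u\<close>.\<close>

definition dvec :: "real ^ 'n \<Rightarrow> (real ^ 'n) list \<Rightarrow> real ^ 'n" where
  "dvec z vs = (\<chi> i. hform h z (axis i 1 # vs))"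

lemma dvec_inner: "dvec z vs \<bullet> w = hform h z (w # vs)"
  by (simp add: dvec_def hform_inner[of z w])

lemma dvec_linear: "dvec z [u + w] = dvec z [u] + dvec z [w]" "dvec z [c *\<^sub>R u] = c *\<^sub>R dvec z [u]" if "z \<in> A"
  using that by (simp_all add: dvec_def vec_eq_iff hform_linear)

lemma dvec_tendsto:
  assumes "list_all2 (\<lambda>g l. g \<longlonglongrightarrow> l) gs vs"
  shows "(\<lambda>n. dvec (x n) (map (\<lambda>g. g n) gs)) \<longlonglongrightarrow> dvec I vs"
proof (rule vec_tendstoI)
  fix i
  show "(\<lambda>n. dvec (x n) (map (\<lambda>g. g n) gs) $ i) \<longlonglongrightarrow> dvec I vs $ i"
    unfolding dvec_def vec_lambda_beta
    using tendsto_hform_seq[of "(\<lambda>n. axis i 1) # gs" "axis i 1 # vs"] assms by simp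
qed

text \<open>For an orthogonal projection \<open>P\<close>, the compression of the Hessian to the
  range of \<open>P\<close>, completed by the identity on the orthogonal complement. This trades
  invertibility on the moving ranges of \<open>Q n\<close> for invertibility on the whole
  space.\<close>

definition comp_op :: "real ^ 'n \<Rightarrow> real ^ 'n ^ 'n \<Rightarrow> real ^ 'n \<Rightarrow> real ^ 'n" where
  "comp_op z P y = P *v dvec z [P *v y] + (y - P *v y)"

lemma linear_comp_op: "z \<in> A \<Longrightarrow> linear (comp_op z P)"
  by (rule linearI)
    (simp_all add: comp_op_def matrix_vector_right_distrib matrix_vector_mult_scaleR
      dvec_linear algebra_simps)

lemma comp_op_tendsto:
  assumes "f \<longlonglongrightarrow> y"
  shows "(\<lambda>n. comp_op (x n) (Q n) (f n)) \<longlonglongrightarrow> comp_op I Q0 y"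
  unfolding comp_op_def
  using dvec_tendsto[of "[\<lambda>n. Q n *v f n]" "[Q0 *v y]"]
  by (intro tendsto_intros Q_tendsto assms) (simp add: Q_tendsto assms)

text \<open>A right-hand side in the range of \<open>P\<close> has no component in the identity
  block, so the solution lies in that range.\<close>

lemma comp_op_range:
  assumes "comp_op z P y = P *v r" and idem: "\<And>w. P *v (P *v w) = P *v w"
  shows "P *v y = y"
proof -
  have "P *v comp_op z P y = P *v dvec z [P *v y]"
    by (simp add: comp_op_def matrix_vector_right_distrib matrix_vector_mult_diff_distrib idem)
  then have "comp_op z P y = P *v dvec z [P *v y]"
    by (simp add: assms)
  then show ?thesis by (simp add: comp_op_def)
qed

text \<open>A kernel vector lies in the range of \<open>Q0\<close> and is isotropic for the Hessian.
  If nonzero, it would span an isotropic plane with \<open>v0\<close>.\<close>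

lemma inj_comp_op: "inj (comp_op I Q0)"
proof -
  have "y = 0" if "comp_op I Q0 y = 0" for y
  proof -
    have y: "Q0 *v y = y"
      by (rule comp_op_range[of I _ _ 0]) (use that in \<open>simp_all add: Q0_idem\<close>)
    then have "Q0 *v dvec I [y] = 0"
      using that by (simp add: comp_op_def)
    then have "dvec I [y] \<bullet> (Q0 *v y) = 0"
      by (metis Q0_sym inner_zero_left)
    then have yy: "hform h I [y, y] = 0"
      by (simp add: y dvec_inner)
    have "hform h I [y] = 0" "hform h I [v0, y] = 0"
      using limit_kernel(2,4)[of y] by (simp_all add: y)
    moreover have "y \<bullet> v0 = 0"
      using Q0_sym[of y v0] by (simp add: y Q0_v0)
    ultimately show ?thesis
      using limit_kernel(1,3) yy v0_norm by (intro no_isotropic_plane[of y v0]) (auto simp: hform_sym)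
  qed
  then show ?thesis
    using linear_injective_0[OF linear_comp_op[OF I_dom]] by blast
qed

lemma eventually_comp_op_bounded_below:
  obtains c where "c > 0" "\<forall>\<^sub>F n in sequentially. \<forall>y. c * norm y \<le> norm (comp_op (x n) (Q n) y)"
  by (rule eventually_bounded_below[where f = "\<lambda>n. comp_op (x n) (Q n)" and g = "comp_op I Q0"])
    (auto intro: linear_comp_op inj_comp_op comp_op_tendsto)

end

section \<open>The curve approximating the points of small gradient\<close>

locale nondegenerate_complement = degenerating A h \<xi> I R x e V vh v0 Q Q0
  for A :: "(real ^ 'n::finite) set" and h \<xi> I R x e V vh v0 Q Q0 +
  fixes c :: real
  assumes c_pos: "c > 0" and comp_op_below: "\<And>n y. c * norm y \<le> norm (comp_op (x n) (Q n) y)"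
begin

lemma comp_op_below_limit: "c * norm y \<le> norm (comp_op I Q0 y)"
  using comp_op_below
  by (intro LIMSEQ_le_const[OF tendsto_norm[OF comp_op_tendsto[OF tendsto_const]]]) auto

lemma comp_op_solve:
  obtains y where "comp_op (x n) (Q n) y = r"
  using surj_of_bounded_below[OF linear_comp_op c_pos comp_op_below] x_dom by (metis surjE)

text \<open>Through the lower bound \<open>c\<close>, the distance of \<open>f n\<close> from
  \<open>y\<close> is controlled by the residual of the fixed \<open>y\<close>, which tends to
  0.\<close>

lemma comp_op_solutions_tendsto:
  assumes "\<And>n. comp_op (x n) (Q n) (f n) = r n" and "comp_op I Q0 y = s" and "r \<longlonglongrightarrow> s"
  shows "f \<longlonglongrightarrow> y"
proof -
  have "(\<lambda>n. r n - comp_op (x n) (Q n) y) \<longlonglongrightarrow> s - s"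
    using comp_op_tendsto[OF tendsto_const, of y] assms(2,3) by (intro tendsto_diff) auto
  then have lim: "(\<lambda>n. norm (r n - comp_op (x n) (Q n) y) / c) \<longlonglongrightarrow> 0"
    by (intro tendsto_divide_zero tendsto_norm_zero) simp
  have "norm (f n - y) \<le> norm (r n - comp_op (x n) (Q n) y) / c" for n
    using comp_op_below[of "f n - y" n] c_pos linear_diff[OF linear_comp_op[OF x_dom], of n "Q n" "f n" y]
    by (simp add: assms(1) pos_le_divide_eq mult.commute)
  then have "(\<lambda>n. f n - y) \<longlonglongrightarrow> 0"
    by (intro Lim_null_comparison[OF _ lim] always_eventually allI)
  then show ?thesis by (simp add: LIM_zero_iff)
qed

text \<open>The correction of \<open>vh n\<close> within the range of \<open>Q n\<close> that makes
  \<open>v n\<close> Hessian-orthogonal to that range, see \<open>v_kernel\<close>.\<close>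

definition z :: "nat \<Rightarrow> real ^ 'n" where
  "z n = (SOME y. comp_op (x n) (Q n) y = Q n *v (- dvec (x n) [vh n]))"

definition v :: "nat \<Rightarrow> real ^ 'n" where "v n = vh n + z n"

text \<open>The second-order coefficient of the curve, chosen so that the quadratic terms of the
  gradient along it cancel when tested against the range of \<open>Q n\<close>, see
  \<open>a_equation\<close>.\<close>

definition a :: "nat \<Rightarrow> real ^ 'n" where
  "a n = (SOME y. comp_op (x n) (Q n) y = (- 1 / 2) *\<^sub>R (Q n *v dvec (x n) [v n, v n]))"

lemma z_solves: "comp_op (x n) (Q n) (z n) = Q n *v (- dvec (x n) [vh n])"
  unfolding z_def by (rule someI_ex) (metis comp_op_solve)

lemma a_solves: "comp_op (x n) (Q n) (a n) = (- 1 / 2) *\<^sub>R (Q n *v dvec (x n) [v n, v n])"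
  unfolding a_def by (rule someI_ex) (metis comp_op_solve)

lemma Q_z: "Q n *v z n = z n"
  by (rule comp_op_range[OF z_solves Q_idem])

lemma Q_a: "Q n *v a n = a n"
  by (rule comp_op_range[of "x n" _ _ "(- 1 / 2) *\<^sub>R dvec (x n) [v n, v n]"])
    (simp_all only: a_solves Q_idem matrix_vector_mult_scaleR)

lemma v_kernel: "hform h (x n) [v n, Q n *v w] = 0"
proof -
  have "Q n *v dvec (x n) [z n] = Q n *v (- dvec (x n) [vh n])"
    using z_solves[of n] by (simp add: comp_op_def Q_z)
  then have "Q n *v dvec (x n) [v n] = Q n *v (dvec (x n) [vh n] + - dvec (x n) [vh n])"
    by (simp only: v_def dvec_linear[OF x_dom] matrix_vector_right_distrib)
  then have "Q n *v dvec (x n) [v n] = 0" by simp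
  then have "(Q n *v dvec (x n) [v n]) \<bullet> w = 0" by simp
  then show ?thesis
    by (simp add: Q_sym dvec_inner hform_swap)
qed

lemma a_equation: "hform h (x n) [a n, Q n *v w] = - hform h (x n) [v n, v n, Q n *v w] / 2"
proof -
  have "Q n *v dvec (x n) [a n] = (- 1 / 2) *\<^sub>R (Q n *v dvec (x n) [v n, v n])"
    using a_solves[of n] by (simp add: comp_op_def Q_a)
  then have "(Q n *v dvec (x n) [a n]) \<bullet> w = (- 1 / 2) * ((Q n *v dvec (x n) [v n, v n]) \<bullet> w)"
    by simp
  then have "hform h (x n) [Q n *v w, a n] = - hform h (x n) [Q n *v w, v n, v n] / 2"
    by (simp add: Q_sym dvec_inner)
  then show ?thesis by (simp add: hform_sym)
qed

text \<open>The right-hand sides tend to 0 because \<open>v0\<close> is Hessian-orthogonal to the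
  range of \<open>Q0\<close>.\<close>

lemma z_lim: "z \<longlonglongrightarrow> 0"
proof (rule comp_op_solutions_tendsto[OF z_solves])
  have "(Q0 *v (- dvec I [v0])) \<bullet> w = 0" for w
    using limit_kernel(4)[of w] by (simp add: Q0_sym dvec_inner hform_swap)
  then have "Q0 *v (- dvec I [v0]) = 0"
    by (metis inner_eq_zero_iff)
  moreover have "(\<lambda>n. Q n *v (- dvec (x n) [vh n])) \<longlonglongrightarrow> Q0 *v (- dvec I [v0])"
    using dvec_tendsto[of "[vh]" "[v0]"] vh_lim by (intro tendsto_intros Q_tendsto) simp
  ultimately show "(\<lambda>n. Q n *v (- dvec (x n) [vh n])) \<longlonglongrightarrow> 0" by simp
  show "comp_op I Q0 0 = 0"
    by (rule linear_0[OF linear_comp_op[OF I_dom]])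
qed

lemma v_lim: "v \<longlonglongrightarrow> v0"
  unfolding v_def using tendsto_add[OF vh_lim z_lim] by simp

text \<open>The limit operator inherits the lower bound \<open>c\<close>, so the limiting equation
  has a solution, to which \<open>a\<close> converges.\<close>

lemma a_convergent: obtains a0 where "a \<longlonglongrightarrow> a0"
proof -
  have "surj (comp_op I Q0)"
    using surj_of_bounded_below[OF linear_comp_op c_pos comp_op_below_limit] I_dom by blast
  then obtain a0 where a0: "comp_op I Q0 a0 = (- 1 / 2) *\<^sub>R (Q0 *v dvec I [v0, v0])"
    by (metis surjE)
  have "(\<lambda>n. (- 1 / 2) *\<^sub>R (Q n *v dvec (x n) [v n, v n]))
      \<longlonglongrightarrow> (- 1 / 2) *\<^sub>R (Q0 *v dvec I [v0, v0])"
    using dvec_tendsto[of "[v, v]" "[v0, v0]"] v_lim by (intro tendsto_intros Q_tendsto) simp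
  from comp_op_solutions_tendsto[OF a_solves a0 this] show thesis by (rule that)
qed

lemma ord_v: "ord 0 v"
  by (rule ord_tendsto[OF v_lim])

lemma ord_a: "ord 0 a"
  by (rule a_convergent) (rule ord_tendsto)

text \<open>The Taylor coefficients at \<open>t = 0\<close> of the derivative of \<open>h\<close> along the curve
  \<open>t \<mapsto> x n + t v n + t\<^sup>2 a n\<close>; those involving \<open>hform h (x n) [v n, a n]\<close> vanish.\<close>

definition p1 where "p1 n = hform h (x n) [v n, v n]"
definition p2 where "p2 n = hform h (x n) [v n, v n, v n] / 2"
definition p3 where "p3 n = 2 * hform h (x n) [a n, a n] + 2 * hform h (x n) [v n, v n, a n]
  + hform h (x n) [v n, v n, v n, v n] / 6"
definition p4 where "p4 n = 5 / 2 * hform h (x n) [v n, a n, a n]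
  + 5 / 6 * hform h (x n) [v n, v n, v n, a n] + hform h (x n) [v n, v n, v n, v n, v n] / 24"

end

section \<open>Deviation of the points of small gradient from the curve\<close>

locale small_gradient_sequence = nondegenerate_complement A h \<xi> I R x e V vh v0 Q Q0 c
  for A :: "(real ^ 'n::finite) set" and h \<xi> I R x e V vh v0 Q Q0 c +
  fixes y :: "nat \<Rightarrow> real ^ 'n"
  assumes y_V: "\<And>n. y n \<in> V n" and y_le: "\<And>n. norm (y n) \<le> \<xi> n"
    and y_small: "\<And>n w. w \<in> V n \<Longrightarrow> \<bar>hform h (x n + y n) [w]\<bar> \<le> e n * norm w"
begin

definition t :: "nat \<Rightarrow> real" where "t n = vh n \<bullet> y n"

text \<open>The deviation of \<open>y n\<close> from the curve point with parameter
  \<open>t n\<close>. As \<open>t n\<close> is the coordinate of \<open>y n\<close> along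
  \<open>vh n\<close>, it lies in the range of \<open>Q n\<close>.\<close>

definition d :: "nat \<Rightarrow> real ^ 'n" where "d n = y n - t n *\<^sub>R v n - (t n)\<^sup>2 *\<^sub>R a n"

lemma y_eq: "y n = t n *\<^sub>R v n + (t n)\<^sup>2 *\<^sub>R a n + d n"
  by (simp add: d_def)

lemma Q_d: "Q n *v d n = d n"
proof -
  have "Q n *v y n = y n - t n *\<^sub>R vh n"
    using V_decomp[OF y_V, of n] by (simp add: t_def algebra_simps)
  then have "Q n *v d n = y n - t n *\<^sub>R vh n - t n *\<^sub>R z n - (t n)\<^sup>2 *\<^sub>R a n"
    by (simp add: d_def v_def matrix_vector_mult_diff_distrib matrix_vector_right_distrib
        matrix_vector_mult_scaleR Q_vh Q_z Q_a)
  then show ?thesis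
    by (simp add: d_def v_def algebra_simps)
qed

lemma ord_y: "ord 1 y"
  by (rule ordI_all[of _ 1]) (simp add: y_le)

lemma ord_t: "ord 1 t"
proof (rule ord_comparison[OF ord_y, of 1])
  show "1 * norm (t n) \<le> norm (y n)" for n
    using Cauchy_Schwarz_ineq2[of "vh n" "y n"] by (simp add: t_def vh_norm)
qed simp

lemma ord_t_power: "ord k (\<lambda>n. t n ^ k)"
  by (rule ord_power[OF ord_t])

lemma ord_ta: "ord 2 (\<lambda>n. (t n)\<^sup>2 *\<^sub>R a n)"
  by (rule ord_scaleR[OF ord_t_power ord_a]) simp

lemma ord_d_1: "ord 1 d"
  unfolding d_def
  by (intro ord_diff ord_y ord_scaleR[OF ord_t ord_v] ord_mono[OF ord_ta]) auto

text \<open>Testing the gradient at \<open>x n + y n\<close> against the unit vector in the direction of the Hessian image of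
  \<open>d\<close> recovers \<open>norm d\<close>; the choice of \<open>v\<close> and \<open>a\<close> cancels all other terms up to order 2.\<close>

lemma ord_d_step:
  assumes "ord k d" and "1 \<le> k" and "k \<le> 2"
  shows "ord (Suc k) d"
proof -
  define q where "q = (\<lambda>n. Q n *v dvec (x n) [d n])"
  define w where "w = (\<lambda>n. sgn (q n))"
  define r where "r = (\<lambda>n. (t n)\<^sup>2 *\<^sub>R a n + d n)"
  have w: "ord 0 w"
    by (rule ordI_all[of _ 1]) (simp add: w_def norm_sgn)
  have Q_w: "Q n *v w n = w n" for n
    by (simp add: w_def q_def sgn_div_norm matrix_vector_mult_scaleR Q_idem)
  have w_V: "w n \<in> V n" for n
    using Q_V[of n "w n"] by (simp add: Q_w)
  have r: "ord k r"
    unfolding r_def using assms by (intro ord_add ord_mono[OF ord_ta]) auto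
  have y_r: "y n = t n *\<^sub>R v n + r n" for n
    by (simp add: r_def y_eq[of n] add.assoc)
  define T where "T = (\<lambda>n. hform h (x n + y n) [w n]
      - (hform h (x n) [w n] + hform h (x n) [y n, w n]
    + hform h (x n) [y n, y n, w n] / 2 + hform h (x n) [y n, y n, y n, w n] / 6
    + hform h (x n) [y n, y n, y n, y n, w n] / 24))"
  have key: "norm (q n) = hform h (x n + y n) [w n] - T n
    - t n * hform h (x n) [v n, r n, w n] - 1 / 2 * hform h (x n) [r n, r n, w n]
    - 1 / 6 * hform h (x n) [y n, y n, y n, w n] - 1 / 24 * hform h (x n) [y n, y n, y n, y n, w n]" for n
  proof -
    have "norm (q n) = q n \<bullet> w n"
      by (cases "q n = 0") (simp_all add: w_def sgn_div_norm dot_square_norm power2_eq_square)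
    also have "\<dots> = hform h (x n) [d n, w n]"
      by (simp add: q_def Q_sym Q_w dvec_inner hform_swap)
    finally have q: "norm (q n) = hform h (x n) [d n, w n]" .
    have "hform h (x n) [v n, w n] = 0"
      using v_kernel[of n "w n"] by (simp add: Q_w)
    moreover have "hform h (x n) [a n, w n] = - hform h (x n) [v n, v n, w n] / 2"
      using a_equation[of n "w n"] by (simp add: Q_w)
    ultimately have "hform h (x n) [y n, w n] = - (t n)\<^sup>2 / 2 * hform h (x n) [v n, v n, w n] + norm (q n)"
      by (simp add: y_eq[of n] hform_linear q)
    moreover have "hform h (x n) [y n, y n, w n] / 2 = (t n)\<^sup>2 / 2 * hform h (x n) [v n, v n, w n]
        + t n * hform h (x n) [v n, r n, w n] + 1 / 2 * hform h (x n) [r n, r n, w n]"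
      by (simp add: y_r[of n] hform_linear hform_sym algebra_simps power2_eq_square)
    moreover have "hform h (x n) [w n] = 0" by (rule V_orthogonal[OF w_V])
    ultimately show ?thesis unfolding T_def by linarith
  qed
  have "ord (Suc k) (\<lambda>n. norm (q n))"
    unfolding key
  proof (intro ord_diff)
    show "ord (Suc k) (\<lambda>n. hform h (x n + y n) [w n])"
      by (rule ord_mono[OF ord_small_gradient[OF y_small w_V w]]) (use assms in auto)
    show "ord (Suc k) T"
      unfolding T_def by (rule ord_mono[OF ord_taylor[OF y_le w]]) (use assms in auto)
    \<comment> \<open>The factor \<open>t n\<close> adds one order to that of \<open>r\<close>,
      which is the gain of one step.\<close>
    show "ord (Suc k) (\<lambda>n. t n * hform h (x n) [v n, r n, w n])"
      by (rule ord_mult[OF ord_t ord_hform_3[OF ord_v r w]]) (rule order_refl, simp)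
    show "ord (Suc k) (\<lambda>n. 1 / 2 * hform h (x n) [r n, r n, w n])"
      by (rule ord_cmult, rule ord_hform_3[OF r r w]) (use assms in auto)
    \<comment> \<open>The term cubic in \<open>y\<close> has order 3, which suffices since
      \<open>k \<le> 2\<close>.\<close>
    show "ord (Suc k) (\<lambda>n. 1 / 6 * hform h (x n) [y n, y n, y n, w n])"
      by (rule ord_cmult, rule ord_hform_4[OF ord_y ord_y ord_y w]) (use assms in auto)
    show "ord (Suc k) (\<lambda>n. 1 / 24 * hform h (x n) [y n, y n, y n, y n, w n])"
      by (rule ord_cmult, rule ord_hform_5[OF ord_y ord_y ord_y ord_y w]) (use assms in auto)
  qed
  \<comment> \<open>On the range of \<open>Q n\<close>, where \<open>d n\<close> lies,
    \<open>comp_op\<close> is the compressed Hessian; its lower bound turns the estimate of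
    \<open>q\<close> into one of \<open>d\<close>.\<close>
  then show ?thesis
  proof (rule ord_comparison[OF _ c_pos])
    show "c * norm (d n) \<le> norm (norm (q n))" for n
      using comp_op_below[of "d n" n] by (simp add: comp_op_def Q_d q_def)
  qed
qed

lemma ord_d: "ord 3 d"
  using ord_d_step[OF ord_d_step[OF ord_d_1]] by (simp add: eval_nat_numeral)

text \<open>The norms of \<open>y n\<close> and \<open>t n *\<^sub>R v n\<close> differ by order 2,
  and \<open>norm (v n)\<close> tends to 1. The sign of \<open>t n\<close> remains
  undetermined.\<close>

lemma t_ratio:
  assumes "\<And>n. norm (y n) = \<rho> * \<xi> n" and "\<rho> \<ge> 0"
  shows "(\<lambda>n. \<bar>t n / \<xi> n\<bar>) \<longlonglongrightarrow> \<rho>"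
proof -
  have nz: "\<xi> n \<noteq> 0" for n using scale_pos[of n] by simp
  define r where "r = (\<lambda>n. (t n)\<^sup>2 *\<^sub>R a n + d n)"
  have "ord (Suc 1) (\<lambda>n. norm (y n) - norm (t n *\<^sub>R v n))"
  proof (rule ord_comparison[where c = 1 and g = r])
    show "ord (Suc 1) r"
      unfolding r_def by (intro ord_add ord_mono[OF ord_ta] ord_mono[OF ord_d]) auto
    show "1 * norm (norm (y n) - norm (t n *\<^sub>R v n)) \<le> norm (r n)" for n
      using norm_triangle_ineq3[of "y n" "t n *\<^sub>R v n"] by (simp add: r_def y_eq[of n] add.assoc)
  qed simp
  from ord_divide_tendsto[OF this]
  have "(\<lambda>n. (norm (y n) - norm (t n *\<^sub>R v n)) / \<xi> n) \<longlonglongrightarrow> 0" by simp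
  moreover have "(norm (y n) - norm (t n *\<^sub>R v n)) / \<xi> n = \<rho> - \<bar>t n / \<xi> n\<bar> * norm (v n)" for n
    using nz[of n] scale_pos[of n] by (simp add: assms(1) diff_divide_distrib)
  ultimately have "(\<lambda>n. \<rho> - (\<rho> - \<bar>t n / \<xi> n\<bar> * norm (v n))) \<longlonglongrightarrow> \<rho> - 0"
    by (intro tendsto_diff tendsto_const) simp
  moreover have nv: "(\<lambda>n. norm (v n)) \<longlonglongrightarrow> 1"
    using tendsto_norm[OF v_lim] by (simp add: v0_norm)
  ultimately have lim: "(\<lambda>n. \<bar>t n / \<xi> n\<bar> * norm (v n) / norm (v n)) \<longlonglongrightarrow> (\<rho> - 0) / 1"
    by (intro tendsto_divide) simp_all
  have "\<forall>\<^sub>F n in sequentially. norm (v n) > 0"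
    using nv by (rule order_tendstoD) simp
  then have "\<forall>\<^sub>F n in sequentially. \<bar>t n / \<xi> n\<bar> * norm (v n) / norm (v n) = \<bar>t n / \<xi> n\<bar>"
    by eventually_elim simp
  with lim show ?thesis by (simp add: tendsto_cong)
qed

text \<open>Testing against the velocity \<open>v n + 2 t a n\<close> of the curve instead of \<open>v n\<close> makes the contribution
  of \<open>d\<close> vanish to order 5.\<close>

lemma reduced_derivative_small:
  "(\<lambda>n. (p1 n * t n + p2 n * t n ^ 2 + p3 n * t n ^ 3 + p4 n * t n ^ 4) / \<xi> n ^ 4) \<longlonglongrightarrow> 0"
proof -
  define w where "w = (\<lambda>n. v n + (2 * t n) *\<^sub>R a n)"
  define r where "r = (\<lambda>n. (t n)\<^sup>2 *\<^sub>R a n + d n)"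
  have w: "ord 0 w"
    unfolding w_def
    by (intro ord_add ord_v ord_scaleR[OF ord_cmult[OF ord_t] ord_a]) simp
  have r: "ord 2 r"
    unfolding r_def by (intro ord_add ord_ta ord_mono[OF ord_d]) auto
  have w_V: "w n \<in> V n" for n
    using vh_V[of n] Q_V[of n "z n"] Q_V[of n "a n"] V_subspace[of n]
    by (simp add: w_def v_def Q_z Q_a subspace_add subspace_scale)
  have y_r: "y n = t n *\<^sub>R v n + r n" for n
    by (simp add: r_def y_eq[of n] add.assoc)
  have va: "hform h (x n) [v n, a n] = 0" and vd: "hform h (x n) [v n, d n] = 0" for n
    using v_kernel[of n "a n"] v_kernel[of n "d n"] by (simp_all add: Q_a Q_d)
  \<comment> \<open>By this identity the terms \<open>t n * hform h (x n) [v n, v n, d n]\<close> of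
    the second- and third-order forms cancel below.\<close>
  have ad: "hform h (x n) [a n, d n] = - hform h (x n) [v n, v n, d n] / 2" for n
    using a_equation[of n "d n"] by (simp add: Q_d)
  \<comment> \<open>\<open>R3\<close>, \<open>R4\<close> and \<open>R5\<close> collect the terms of
    order at least 5 in the forms of degree 3, 4 and 5.\<close>
  define R3 where "R3 = (\<lambda>n. t n ^ 5 * hform h (x n) [a n, a n, a n] + 2 * t n ^ 2 * hform h (x n) [v n, d n, a n]
      + t n ^ 2 * hform h (x n) [a n, d n, w n] + 1 / 2 * hform h (x n) [d n, d n, w n])"
  define R4 where "R4 = (\<lambda>n. t n ^ 5 * hform h (x n) [v n, v n, a n, a n]
      + 1 / 2 * (t n ^ 2 * hform h (x n) [v n, v n, d n, w n])
      + 1 / 2 * (t n * hform h (x n) [v n, r n, r n, w n]) + 1 / 6 * hform h (x n) [r n, r n, r n, w n])"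
  define R5 where "R5 = (\<lambda>n. 1 / 12 * (t n ^ 5 * hform h (x n) [v n, v n, v n, v n, a n])
      + 1 / 6 * (t n ^ 3 * hform h (x n) [v n, v n, v n, r n, w n])
      + 1 / 4 * (t n ^ 2 * hform h (x n) [v n, v n, r n, r n, w n])
      + 1 / 6 * (t n * hform h (x n) [v n, r n, r n, r n, w n])
      + 1 / 24 * hform h (x n) [r n, r n, r n, r n, w n])"
  define T where "T = (\<lambda>n. hform h (x n + y n) [w n] - (hform h (x n) [w n] + hform h (x n) [y n, w n]
        + hform h (x n) [y n, y n, w n] / 2 + hform h (x n) [y n, y n, y n, w n] / 6
        + hform h (x n) [y n, y n, y n, y n, w n] / 24))"
  have "p1 n * t n + p2 n * t n ^ 2 + p3 n * t n ^ 3 + p4 n * t n ^ 4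
      = hform h (x n + y n) [w n] - (T n + (R3 n + (R4 n + R5 n)))" for n
  proof -
    have e2: "hform h (x n) [y n, w n] = t n * hform h (x n) [v n, v n]
        + 2 * t n ^ 3 * hform h (x n) [a n, a n] - t n * hform h (x n) [v n, v n, d n]"
      using hform_2_expand[OF x_dom _ y_eq va vd, of "w n"] ad[of n] by (simp add: w_def)
    have e3: "hform h (x n) [y n, y n, w n] / 2
      = t n ^ 2 / 2 * hform h (x n) [v n, v n, v n] + 2 * t n ^ 3 * hform h (x n) [v n, v n, a n]
        + 5 / 2 * t n ^ 4 * hform h (x n) [v n, a n, a n] + t n * hform h (x n) [v n, v n, d n] + R3 n"
      using hform_3_expand[OF x_dom _ y_eq, of "w n"] by (simp add: w_def R3_def)
    have e4: "hform h (x n) [y n, y n, y n, w n] / 6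
      = t n ^ 3 / 6 * hform h (x n) [v n, v n, v n, v n] + 5 / 6 * t n ^ 4 * hform h (x n) [v n, v n, v n, a n] + R4 n"
    proof -
      have "hform h (x n) [v n, v n, v n, w n]
          = hform h (x n) [v n, v n, v n, v n] + 2 * t n * hform h (x n) [v n, v n, v n, a n]"
        "hform h (x n) [v n, v n, r n, w n] = t n ^ 2 * hform h (x n) [v n, v n, v n, a n]
          + 2 * t n ^ 3 * hform h (x n) [v n, v n, a n, a n] + hform h (x n) [v n, v n, d n, w n]"
        by (simp_all add: w_def r_def hform_linear hform_sym algebra_simps eval_nat_numeral)
      then show ?thesis
        unfolding y_r[of n] hform_4_power[OF x_dom] R4_def by (simp add: algebra_simps eval_nat_numeral)
    qed
    have e5: "hform h (x n) [y n, y n, y n, y n, w n] / 24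
      = t n ^ 4 / 24 * hform h (x n) [v n, v n, v n, v n, v n] + R5 n"
    proof -
      have "hform h (x n) [v n, v n, v n, v n, w n]
          = hform h (x n) [v n, v n, v n, v n, v n] + 2 * t n * hform h (x n) [v n, v n, v n, v n, a n]"
        by (simp add: w_def hform_linear)
      then show ?thesis
        unfolding y_r[of n] hform_5_power[OF x_dom] R5_def by (simp add: algebra_simps eval_nat_numeral)
    qed
    show ?thesis
      unfolding T_def e2 e3 e4 e5 V_orthogonal[OF w_V] p1_def p2_def p3_def p4_def
      by (simp add: algebra_simps)
  qed
  moreover have "(\<lambda>n. (hform h (x n + y n) [w n] - (T n + (R3 n + (R4 n + R5 n)))) / \<xi> n ^ 4) \<longlonglongrightarrow> 0"
  proof -
    have "ord 5 T"
      unfolding T_def by (rule ord_taylor[OF y_le w])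
    moreover have "ord 5 R3"
      unfolding R3_def mult.assoc
      by (intro ord_add ord_cmult ord_mult[OF ord_t_power ord_hform_3[OF ord_a ord_a ord_a order_refl]]
          ord_mult[OF ord_t_power ord_hform_3[OF ord_v ord_d ord_a order_refl]]
          ord_mult[OF ord_t_power ord_hform_3[OF ord_a ord_d w order_refl]] ord_hform_3[OF ord_d ord_d w])
        simp_all
    moreover have "ord 5 R4"
      unfolding R4_def mult.assoc
      by (intro ord_add ord_cmult ord_mult[OF ord_t_power ord_hform_4[OF ord_v ord_v ord_a ord_a order_refl]]
          ord_mult[OF ord_t_power ord_hform_4[OF ord_v ord_v ord_d w order_refl]]
          ord_mult[OF ord_t ord_hform_4[OF ord_v r r w order_refl]] ord_hform_4[OF r r r w])
        simp_all
    moreover have "ord 5 R5"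
      unfolding R5_def mult.assoc
      by (intro ord_add ord_cmult ord_mult[OF ord_t_power ord_hform_5[OF ord_v ord_v ord_v ord_v ord_a order_refl]]
          ord_mult[OF ord_t_power ord_hform_5[OF ord_v ord_v ord_v r w order_refl]]
          ord_mult[OF ord_t_power ord_hform_5[OF ord_v ord_v r r w order_refl]]
          ord_mult[OF ord_t ord_hform_5[OF ord_v r r r w order_refl]] ord_hform_5[OF r r r r w])
        simp_all
    ultimately have "ord (Suc 4) (\<lambda>n. T n + (R3 n + (R4 n + R5 n)))"
      by (simp add: ord_add)
    then have rem: "(\<lambda>n. (T n + (R3 n + (R4 n + R5 n))) / \<xi> n ^ 4) \<longlonglongrightarrow> 0"
      by (rule ord_divide_tendsto)
    \<comment> \<open>Here the convergence of \<open>e n / \<xi> n ^ 4\<close> to 0 enters; a bound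
      of order 4 would only give a bounded quotient.\<close>
    have "(\<lambda>n. hform h (x n + y n) [w n] / \<xi> n ^ 4) \<longlonglongrightarrow> 0"
    proof (rule Lim_null_comparison)
      have "\<bar>hform h (x n + y n) [w n]\<bar> / \<xi> n ^ 4 \<le> e n * norm (w n) / \<xi> n ^ 4" for n
        using y_small[OF w_V] scale_pos[of n] by (intro divide_right_mono) auto
      then show "\<forall>\<^sub>F n in sequentially.
          norm (hform h (x n + y n) [w n] / \<xi> n ^ 4) \<le> e n / \<xi> n ^ 4 * norm (w n)"
        using scale_pos by (intro always_eventually allI) (simp add: abs_mult)
      have "t \<longlonglongrightarrow> 0"
        using ord_divide_tendsto[of 0 t] ord_t by simp
      obtain a0 where "a \<longlonglongrightarrow> a0" by (rule a_convergent)
      then have "(\<lambda>n. v n + (2 * t n) *\<^sub>R a n) \<longlonglongrightarrow> v0 + (2 * 0) *\<^sub>R a0"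
        by (intro tendsto_intros v_lim \<open>t \<longlonglongrightarrow> 0\<close>)
      then have "w \<longlonglongrightarrow> v0"
        by (simp add: w_def)
      from tendsto_mult[OF e_small tendsto_norm[OF this]]
      show "(\<lambda>n. e n / \<xi> n ^ 4 * norm (w n)) \<longlonglongrightarrow> 0" by simp
    qed
    from tendsto_diff[OF this rem] show ?thesis
      by (simp add: diff_divide_distrib)
  qed
  ultimately show ?thesis by simp
qed

end

section \<open>Limiting identities for the jet at \<open>I\<close>\<close>

context nondegenerate_complement
begin

text \<open>In the rescaled parameter \<open>t n / \<xi> n\<close> the reduced derivative over
  \<open>\<xi> n ^ 4\<close> is a quartic without constant term that tends to 0 at four nodes with
  distinct limiting absolute values.\<close>

lemma coefficients_tendsto_0: "p2 \<longlonglongrightarrow> 0" "p3 \<longlonglongrightarrow> 0" "p4 \<longlonglongrightarrow> 0"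
proof -
  \<comment> \<open>The relative radii 1/4, 1/2, 3/4 and 1 supply the four nodes.\<close>
  define \<rho> where "\<rho> = (\<lambda>j. (real j + 1) / 4)"
  have "\<exists>y. \<forall>n. y n \<in> V n \<and> norm (y n) = \<rho> j * \<xi> n
      \<and> (\<forall>w\<in>V n. \<bar>hform h (x n + y n) [w]\<bar> \<le> e n * norm w)" if "j < 4" for j
  proof (intro choice allI)
    fix n
    have "0 \<le> \<rho> j * \<xi> n" "\<rho> j * \<xi> n \<le> \<xi> n"
      using scale_pos[of n] that by (auto simp: \<rho>_def mult_le_cancel_right1 field_simps)
    then show "\<exists>y. y \<in> V n \<and> norm y = \<rho> j * \<xi> n \<and> (\<forall>w\<in>V n. \<bar>hform h (x n + y) [w]\<bar> \<le> e n * norm w)"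
      using small_gradient[of "\<rho> j * \<xi> n" n] by blast
  qed
  then obtain y where y: "\<And>j n. j < 4 \<Longrightarrow> y j n \<in> V n" "\<And>j n. j < 4 \<Longrightarrow> norm (y j n) = \<rho> j * \<xi> n"
    "\<And>j n w. j < 4 \<Longrightarrow> w \<in> V n \<Longrightarrow> \<bar>hform h (x n + y j n) [w]\<bar> \<le> e n * norm w"
    by metis
  define s where "s = (\<lambda>j n. (vh n \<bullet> y j n) / \<xi> n)"
  have nz: "\<xi> n \<noteq> 0" for n using scale_pos[of n] by simp
  have seq: "small_gradient_sequence A h \<xi> I R x e V vh v0 Q Q0 c (y j)" if "j < 4" for j
  proof unfold_locales
    have "\<rho> j \<le> 1" using that by (simp add: \<rho>_def)
    then show "norm (y j n) \<le> \<xi> n" for n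
      using y(2)[OF that, of n] mult_right_mono[of "\<rho> j" 1 "\<xi> n"] scale_pos[of n] by simp
  qed (use y that in auto)
  have "(\<lambda>n. \<bar>s j n\<bar>) \<longlonglongrightarrow> \<rho> j" if "j < 4" for j
  proof -
    interpret small_gradient_sequence A h \<xi> I R x e V vh v0 Q Q0 c "y j"
      by (rule seq[OF that])
    show ?thesis
      using t_ratio[OF y(2)[OF that]] by (simp add: \<rho>_def s_def t_def)
  qed
  moreover have "(\<lambda>n. p1 n * \<xi> n / \<xi> n ^ 4 * s j n + p2 n * \<xi> n ^ 2 / \<xi> n ^ 4 * s j n ^ 2
      + p3 n * \<xi> n ^ 3 / \<xi> n ^ 4 * s j n ^ 3 + p4 n * s j n ^ 4) \<longlonglongrightarrow> 0" if "j < 4" for j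
  proof -
    interpret small_gradient_sequence A h \<xi> I R x e V vh v0 Q Q0 c "y j"
      by (rule seq[OF that])
    have "t n = \<xi> n * s j n" for n
      using nz by (simp add: s_def t_def)
    then have "(p1 n * t n + p2 n * t n ^ 2 + p3 n * t n ^ 3 + p4 n * t n ^ 4) / \<xi> n ^ 4
      = p1 n * \<xi> n / \<xi> n ^ 4 * s j n + p2 n * \<xi> n ^ 2 / \<xi> n ^ 4 * s j n ^ 2
      + p3 n * \<xi> n ^ 3 / \<xi> n ^ 4 * s j n ^ 3 + p4 n * s j n ^ 4" for n
      using nz[of n] by (simp add: power_mult_distrib add_divide_distrib)
    then show ?thesis using reduced_derivative_small by simp
  qed
  moreover have "\<rho> j > 0" "inj_on \<rho> {..<4}" for j
    by (auto simp: \<rho>_def inj_on_def)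
  ultimately have lim: "(\<lambda>n. p2 n * \<xi> n ^ 2 / \<xi> n ^ 4) \<longlonglongrightarrow> 0"
    "(\<lambda>n. p3 n * \<xi> n ^ 3 / \<xi> n ^ 4) \<longlonglongrightarrow> 0" and p4: "p4 \<longlonglongrightarrow> 0"
    using quartic_coeffs_tendsto_zero[of s \<rho> "\<lambda>n. p1 n * \<xi> n / \<xi> n ^ 4" "\<lambda>n. p2 n * \<xi> n ^ 2 / \<xi> n ^ 4"
        "\<lambda>n. p3 n * \<xi> n ^ 3 / \<xi> n ^ 4" p4] by blast+
  show "p4 \<longlonglongrightarrow> 0" by (rule p4)
  \<comment> \<open>Multiplication by powers of \<open>\<xi> n\<close> undoes the rescaling of
    \<open>p2\<close> and \<open>p3\<close>.\<close>
  have pw: "(\<lambda>n. \<xi> n ^ k) \<longlonglongrightarrow> 0 ^ k" for k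
    by (intro tendsto_intros scale_null)
  show "p2 \<longlonglongrightarrow> 0" "p3 \<longlonglongrightarrow> 0"
    using tendsto_mult[OF lim(1) pw[of 2]] tendsto_mult[OF lim(2) pw[of 1]] nz
    by (simp_all add: eval_nat_numeral)
qed

text \<open>Limits of \<open>p2\<close>, \<open>p3\<close>, \<open>p4\<close> and of
  \<open>a_equation\<close> tested against \<open>a n\<close> itself; \<open>a0\<close> lies in the
  range of \<open>Q0\<close>, so \<open>limit_kernel\<close> applies to it.\<close>

lemma limit_jet_aux:
  obtains a0 where "hform h I [a0] = 0" "hform h I [v0, a0] = 0" "hform h I [v0, v0, v0] = 0"
    "hform h I [a0, a0] = - hform h I [v0, v0, a0] / 2"
    "2 * hform h I [a0, a0] + 2 * hform h I [v0, v0, a0] + hform h I [v0, v0, v0, v0] / 6 = 0"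
    "5 / 2 * hform h I [v0, a0, a0] + 5 / 6 * hform h I [v0, v0, v0, a0]
      + hform h I [v0, v0, v0, v0, v0] / 24 = 0"
proof -
  obtain a0 where a0: "a \<longlonglongrightarrow> a0" by (rule a_convergent)
  have Q_a0: "Q0 *v a0 = a0"
    using LIMSEQ_unique[OF Q_tendsto[OF a0]] a0 by (simp add: Q_a)
  have 2: "hform h I [a0, a0] = - hform h I [v0, v0, a0] / 2"
  proof -
    have "(\<lambda>n. hform h (x n) [a n, a n]) \<longlonglongrightarrow> hform h I [a0, a0]"
      using tendsto_hform_seq[of "[a, a]" "[a0, a0]"] a0 by simp
    moreover have "(\<lambda>n. - hform h (x n) [v n, v n, a n] / 2) \<longlonglongrightarrow> - hform h I [v0, v0, a0] / 2"
      using tendsto_hform_seq[of "[v, v, a]" "[v0, v0, a0]"] a0 v_lim by (intro tendsto_intros) simp_all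
    moreover have "hform h (x n) [a n, a n] = - hform h (x n) [v n, v n, a n] / 2" for n
      using a_equation[of n "a n"] by (simp add: Q_a)
    ultimately show ?thesis by (simp add: LIMSEQ_unique)
  qed
  have "p2 \<longlonglongrightarrow> hform h I [v0, v0, v0] / 2"
    unfolding p2_def using tendsto_hform_seq[of "[v, v, v]" "[v0, v0, v0]"] v_lim
    by (intro tendsto_intros) simp_all
  then have 3: "hform h I [v0, v0, v0] = 0"
    using LIMSEQ_unique coefficients_tendsto_0(1) by fastforce
  have "p3 \<longlonglongrightarrow> 2 * hform h I [a0, a0] + 2 * hform h I [v0, v0, a0] + hform h I [v0, v0, v0, v0] / 6"
    unfolding p3_def using a0 v_lim tendsto_hform_seq[of "[a, a]" "[a0, a0]"]
      tendsto_hform_seq[of "[v, v, a]" "[v0, v0, a0]"] tendsto_hform_seq[of "[v, v, v, v]" "[v0, v0, v0, v0]"]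
    by (intro tendsto_intros) simp_all
  then have 4: "2 * hform h I [a0, a0] + 2 * hform h I [v0, v0, a0] + hform h I [v0, v0, v0, v0] / 6 = 0"
    using LIMSEQ_unique coefficients_tendsto_0(2) by blast
  have "p4 \<longlonglongrightarrow> 5 / 2 * hform h I [v0, a0, a0] + 5 / 6 * hform h I [v0, v0, v0, a0]
      + hform h I [v0, v0, v0, v0, v0] / 24"
    unfolding p4_def using a0 v_lim tendsto_hform_seq[of "[v, a, a]" "[v0, a0, a0]"]
      tendsto_hform_seq[of "[v, v, v, a]" "[v0, v0, v0, a0]"]
      tendsto_hform_seq[of "[v, v, v, v, v]" "[v0, v0, v0, v0, v0]"]
    by (intro tendsto_intros) simp_all
  then have 5: "5 / 2 * hform h I [v0, a0, a0] + 5 / 6 * hform h I [v0, v0, v0, a0]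
      + hform h I [v0, v0, v0, v0, v0] / 24 = 0"
    using LIMSEQ_unique coefficients_tendsto_0(3) by blast
  show thesis
    using that[of a0] limit_kernel(2,4)[of a0] 2 3 4 5 by (simp add: Q_a0)
qed

end

context degenerating
begin

text \<open>The lower bound for \<open>comp_op\<close> holds from some index \<open>N\<close> on, so
  the sequences are shifted by \<open>N\<close>.\<close>

lemma limit_jet:
  obtains a0 where "hform h I [a0] = 0" "hform h I [v0, a0] = 0" "hform h I [v0, v0, v0] = 0"
    "hform h I [a0, a0] = - hform h I [v0, v0, a0] / 2"
    "2 * hform h I [a0, a0] + 2 * hform h I [v0, v0, a0] + hform h I [v0, v0, v0, v0] / 6 = 0"
    "5 / 2 * hform h I [v0, a0, a0] + 5 / 6 * hform h I [v0, v0, v0, a0]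
      + hform h I [v0, v0, v0, v0, v0] / 24 = 0"
proof -
  obtain c N where c: "c > 0" "\<And>n y. n \<ge> N \<Longrightarrow> c * norm y \<le> norm (comp_op (x n) (Q n) y)"
    by (rule eventually_comp_op_bounded_below) (auto simp: eventually_sequentially)
  interpret shift: nondegenerate_complement A h "\<lambda>n. \<xi> (n + N)" I R "\<lambda>n. x (n + N)" "\<lambda>n. e (n + N)"
    "\<lambda>n. V (n + N)" "\<lambda>n. vh (n + N)" v0 "\<lambda>n. Q (n + N)" Q0 c
  proof unfold_locales
    show "(\<lambda>n. \<xi> (n + N)) \<longlonglongrightarrow> 0" "(\<lambda>n. x (n + N)) \<longlonglongrightarrow> I" "(\<lambda>n. vh (n + N)) \<longlonglongrightarrow> v0"
      "(\<lambda>n. Q (n + N)) \<longlonglongrightarrow> Q0" "(\<lambda>n. e (n + N) / \<xi> (n + N) ^ 4) \<longlonglongrightarrow> 0"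
      using LIMSEQ_ignore_initial_segment[OF scale_null] LIMSEQ_ignore_initial_segment[OF x_lim]
        LIMSEQ_ignore_initial_segment[OF vh_lim] LIMSEQ_ignore_initial_segment[OF Q_lim]
        LIMSEQ_ignore_initial_segment[OF e_small] by auto
    show "u = 0" if "hform h I [u] = 0" "hform h I [v] = 0" "hform h I [u, u] = 0"
      "hform h I [u, v] = 0" "hform h I [v, v] = 0" "u \<bullet> v = 0" "v \<noteq> 0" for u v
      using that by (rule no_isotropic_plane)
  qed (use scale_pos ball_dom near_center V_orthogonal V_subspace V_decomp vh_V Q_V vh_norm Q_idem
      Q_sym Q_vh small_gradient_vh small_gradient c in auto)
  show thesis using shift.limit_jet_aux that by blast
qed

end

section \<open>Extraction of convergent data; gradients of restrictions\<close>

context smooth_function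
begin

lemma small_gradients_jet:
  fixes I :: "real ^ 'n"
  assumes "cball I R \<subseteq> A" and near: "\<And>n. norm (x n - I) + \<xi> n \<le> R" and x: "x \<longlonglongrightarrow> I"
    and pos: "\<And>n. \<xi> n > 0" and null: "\<xi> \<longlonglongrightarrow> 0" and e: "(\<lambda>n. e n / \<xi> n ^ 4) \<longlonglongrightarrow> 0"
    and V_orth: "\<And>n w. w \<in> V n \<Longrightarrow> hform h (x n) [w] = 0" and V_sub: "\<And>n. subspace (V n)"
    and small: "\<And>n \<eta>. 0 \<le> \<eta> \<Longrightarrow> \<eta> \<le> \<xi> n \<Longrightarrow>
      \<exists>y\<in>V n. norm y = \<eta> \<and> (\<forall>w\<in>V n. \<bar>hform h (x n + y) [w]\<bar> \<le> e n * norm w)"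
    and no_plane: "\<And>u v. hform h I [u] = 0 \<Longrightarrow> hform h I [v] = 0 \<Longrightarrow> hform h I [u, u] = 0 \<Longrightarrow>
      hform h I [u, v] = 0 \<Longrightarrow> hform h I [v, v] = 0 \<Longrightarrow> u \<bullet> v = 0 \<Longrightarrow> v \<noteq> 0 \<Longrightarrow> u = 0"
  obtains v a where "v \<noteq> 0" "hform h I [v] = 0" "hform h I [v, v] = 0" "hform h I [v, v, v] = 0"
    "hform h I [a] = 0" "hform h I [v, a] = 0" "hform h I [a, a] = - hform h I [v, v, a] / 2"
    "2 * hform h I [a, a] + 2 * hform h I [v, v, a] + hform h I [v, v, v, v] / 6 = 0"
    "5 / 2 * hform h I [v, a, a] + 5 / 6 * hform h I [v, v, v, a] + hform h I [v, v, v, v, v] / 24 = 0"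
proof -
  have "\<forall>n. \<exists>y. y \<in> V n \<and> norm y = \<xi> n \<and> (\<forall>w\<in>V n. \<bar>hform h (x n + y) [w]\<bar> \<le> e n * norm w)"
    using small[OF less_imp_le[OF pos] order_refl] by blast
  then obtain y where y: "\<And>n. y n \<in> V n" "\<And>n. norm (y n) = \<xi> n"
    "\<And>n w. w \<in> V n \<Longrightarrow> \<bar>hform h (x n + y n) [w]\<bar> \<le> e n * norm w" by metis
  \<comment> \<open>The direction of the point of small gradient on the largest sphere.\<close>
  define vh where "vh = (\<lambda>n. (1 / \<xi> n) *\<^sub>R y n)"
  have y_vh: "y n = \<xi> n *\<^sub>R vh n" and vh_norm: "norm (vh n) = 1" and vh_V: "vh n \<in> V n" for n
    using pos[of n] y(1,2)[of n] V_sub[of n] by (simp_all add: vh_def subspace_scale)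
  define S where "S = (\<lambda>n. V n \<inter> {w. vh n \<bullet> w = 0})"
  have S: "subspace (S n)" for n
    unfolding S_def by (intro subspace_inter V_sub subspace_hyperplane)
  have "\<exists>P :: real ^ 'n ^ 'n. (\<forall>y. P *v y \<in> S n) \<and> (\<forall>y\<in>S n. P *v y = y)
      \<and> (\<forall>u w. (P *v u) \<bullet> w = u \<bullet> (P *v w)) \<and> norm P \<le> real CARD('n)" for n
    using orthogonal_projection_matrix[OF S[of n]] by metis
  then obtain Q :: "nat \<Rightarrow> real ^ 'n ^ 'n" where Q: "\<And>n y. Q n *v y \<in> S n" "\<And>n y. y \<in> S n \<Longrightarrow> Q n *v y = y"
    "\<And>n u w. (Q n *v u) \<bullet> w = u \<bullet> (Q n *v w)" "\<And>n. norm (Q n) \<le> real CARD('n)" by metis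
  have Q_vh: "Q n *v vh n = 0" for n
  proof -
    have "(Q n *v vh n) \<bullet> w = 0" for w
      using Q(1)[of n w] by (simp add: Q(3) S_def)
    then show ?thesis by (metis inner_eq_zero_iff)
  qed
  have decomp: "w = (vh n \<bullet> w) *\<^sub>R vh n + Q n *v w" if "w \<in> V n" for n w
  proof -
    have "w - (vh n \<bullet> w) *\<^sub>R vh n \<in> S n"
      using that vh_V[of n] V_sub[of n] vh_norm[of n]
      by (auto simp: S_def subspace_diff subspace_scale inner_diff_right dot_square_norm)
    from Q(2)[OF this] show ?thesis
      by (simp add: matrix_vector_mult_diff_distrib matrix_vector_mult_scaleR Q_vh algebra_simps)
  qed
  \<comment> \<open>Unit vectors and projections stay in a bounded set of a finite-dimensional
    space, so one subsequence makes both converge.\<close>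
  have "bounded (range (\<lambda>n. (vh n, Q n)))"
  proof (rule boundedI)
    fix p assume "p \<in> range (\<lambda>n. (vh n, Q n))"
    then obtain n where p: "p = (vh n, Q n)" by blast
    then show "norm p \<le> 1 + real CARD('n)"
      using norm_Pair_le[of "vh n" "Q n"] Q(4)[of n] vh_norm[of n] by simp
  qed
  then obtain l r where r: "strict_mono (r :: nat \<Rightarrow> nat)" and l: "((\<lambda>n. (vh n, Q n)) \<circ> r) \<longlonglongrightarrow> l"
    using bounded_imp_convergent_subsequence by blast
  have vh_lim: "(\<lambda>n. vh (r n)) \<longlonglongrightarrow> fst l" and Q_lim: "(\<lambda>n. Q (r n)) \<longlonglongrightarrow> snd l"
    using tendsto_fst[OF l] tendsto_snd[OF l] by (simp_all add: o_def)
  interpret degenerating A h "\<lambda>n. \<xi> (r n)" I R "\<lambda>n. x (r n)" "\<lambda>n. e (r n)" "\<lambda>n. V (r n)"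
    "\<lambda>n. vh (r n)" "fst l" "\<lambda>n. Q (r n)" "snd l"
  proof unfold_locales
    show "(\<lambda>n. \<xi> (r n)) \<longlonglongrightarrow> 0" "(\<lambda>n. x (r n)) \<longlonglongrightarrow> I" "(\<lambda>n. e (r n) / \<xi> (r n) ^ 4) \<longlonglongrightarrow> 0"
      using LIMSEQ_subseq_LIMSEQ[OF null r] LIMSEQ_subseq_LIMSEQ[OF x r] LIMSEQ_subseq_LIMSEQ[OF e r]
      by (simp_all add: o_def)
    show "\<bar>hform h (x (r n) + \<xi> (r n) *\<^sub>R vh (r n)) [w]\<bar> \<le> e (r n) * norm w" if "w \<in> V (r n)" for n w
      using y(3)[OF that] by (simp add: y_vh)
    show "u = 0" if "hform h I [u] = 0" "hform h I [v] = 0" "hform h I [u, u] = 0"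
      "hform h I [u, v] = 0" "hform h I [v, v] = 0" "u \<bullet> v = 0" "v \<noteq> 0" for u v
      using that by (rule no_plane)
    show "Q (r n) *v y \<in> V (r n)" for n y
      using Q(1) by (auto simp: S_def)
    show "w = (vh (r n) \<bullet> w) *\<^sub>R vh (r n) + Q (r n) *v w" if "w \<in> V (r n)" for n w
      using decomp[OF that] .
    show "(Q (r n) *v y) \<bullet> w = y \<bullet> (Q (r n) *v w)" for n y w by (rule Q(3))
    show "\<exists>y\<in>V (r n). norm y = \<eta> \<and> (\<forall>w\<in>V (r n). \<bar>hform h (x (r n) + y) [w]\<bar> \<le> e (r n) * norm w)"
      if "0 \<le> \<eta>" "\<eta> \<le> \<xi> (r n)" for n \<eta>
      using small[OF that] .
  qed (use assms(1) near pos V_orth V_sub vh_V vh_norm Q Q_vh vh_lim Q_lim in auto)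
  have "fst l \<noteq> 0" using v0_norm by auto
  obtain a where "hform h I [a] = 0" "hform h I [fst l, a] = 0" "hform h I [fst l, fst l, fst l] = 0"
    "hform h I [a, a] = - hform h I [fst l, fst l, a] / 2"
    "2 * hform h I [a, a] + 2 * hform h I [fst l, fst l, a] + hform h I [fst l, fst l, fst l, fst l] / 6 = 0"
    "5 / 2 * hform h I [fst l, a, a] + 5 / 6 * hform h I [fst l, fst l, fst l, a]
      + hform h I [fst l, fst l, fst l, fst l, fst l] / 24 = 0"
    by (rule limit_jet)
  with \<open>fst l \<noteq> 0\<close> limit_kernel(1,3) show thesis
    using that by blast
qed

text \<open>The restricted gradient is the orthogonal projection of the full gradient onto the
  direction space of \<open>L\<close>.\<close>

lemma gradient_restrict_properties:
  assumes "affine L" and "y \<in> L" and "y \<in> A"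
  shows "w \<in> (\<lambda>z. z - y) ` L \<Longrightarrow> gradient_restrict h L y \<bullet> w = hform h y [w]"
    and "norm (gradient_restrict h L y) \<le> norm (gradient h y)"
proof -
  define V where "V = (\<lambda>z. z - y) ` L"
  have V: "subspace V" "span V = V"
    using affine_diffs_subspace_subtract[OF assms(1,2)] by (simp_all add: V_def span_eq_iff)
  obtain P :: "real ^ 'n ^ 'n" where P: "\<And>w. P *v w \<in> V" "\<And>w. w \<in> V \<Longrightarrow> P *v w = w"
    "\<And>u w. (P *v u) \<bullet> w = u \<bullet> (P *v w)"
    using orthogonal_projection_matrix[OF V(1)] by metis
  let ?G = "gradient h y"
  define g where "g = P *v ?G"
  have g_V: "g \<in> V" by (simp add: g_def P)
  \<comment> \<open>Derivatives within \<open>L\<close> are determined only on its direction space;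
    lines through \<open>y\<close> reduce this to uniqueness in one variable.\<close>
  have along: "f w = f' w"
    if "(h has_derivative f) (at y within L)" "(h has_derivative f') (at y within L)" "w \<in> V" for f f' w
  proof -
    have "y + s *\<^sub>R w \<in> L" for s
    proof -
      have "s *\<^sub>R w \<in> V" using V(1) that(3) by (rule subspace_scale)
      then show ?thesis by (auto simp: V_def)
    qed
    then have sub: "range (\<lambda>s. y + s *\<^sub>R w) \<subseteq> L" by blast
    have line: "((\<lambda>s. y + s *\<^sub>R w) has_derivative (\<lambda>s. s *\<^sub>R w)) (at 0)"
      by (auto intro!: derivative_eq_intros)
    have "((\<lambda>s. h (y + s *\<^sub>R w)) has_derivative (\<lambda>s. k (s *\<^sub>R w))) (at 0)"
      if "(h has_derivative k) (at y within L)" for k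
      by (rule has_derivative_in_compose[OF line]) (use has_derivative_subset[OF that sub] in simp)
    from has_derivative_unique[OF this[OF that(1)] this[OF that(2)]] show ?thesis
      by (metis scaleR_one)
  qed
  have D: "(h has_derivative (\<lambda>w. ?G \<bullet> w)) (at y within L)"
    using gradient_inner(2)[OF assms(3)] by (rule has_derivative_at_withinI)
  have G_g: "?G \<bullet> w = g \<bullet> w" if "w \<in> V" for w
    using P(3)[of ?G w] P(2)[OF that] by (simp add: g_def)
  \<comment> \<open>The difference quotient is evaluated only on \<open>L\<close>, where the
    gradient and its projection \<open>g\<close> act alike.\<close>
  have ev: "\<forall>\<^sub>F z in at y within L. (1 / norm (z - y)) *\<^sub>R (h z - (h y + ?G \<bullet> (z - y)))
      = (1 / norm (z - y)) *\<^sub>R (h z - (h y + g \<bullet> (z - y)))"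
    unfolding eventually_at_filter by (intro always_eventually) (auto simp: G_g V_def)
  have g: "(h has_derivative (\<lambda>w. g \<bullet> w)) (at y within L)"
    using D unfolding has_derivative_within tendsto_cong[OF ev]
    by (simp only: bounded_linear_inner_right)
  have "gradient_restrict h L y = g"
    unfolding gradient_restrict_def V_def[symmetric] V(2)
  proof (rule the_equality)
    fix g' assume g': "g' \<in> V \<and> (h has_derivative (\<lambda>w. g' \<bullet> w)) (at y within L)"
    then have "g' - g \<in> V"
      using g_V V(1) by (simp add: subspace_diff)
    then have "(g' - g) \<bullet> (g' - g) = 0"
      using along[of "\<lambda>w. g' \<bullet> w" "\<lambda>w. g \<bullet> w" "g' - g"] g g' by (simp add: inner_diff_left)
    then show "g' = g" by simp
  qed (use g g_V in auto)
  moreover have "norm g \<le> norm ?G"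
  proof -
    have "norm g * norm g = ?G \<bullet> g"
      using G_g[OF g_V] by (simp add: norm_eq_sqrt_inner)
    also have "\<dots> \<le> norm ?G * norm g" by (rule norm_cauchy_schwarz)
    finally show ?thesis
      by (cases "g = 0") (auto simp: mult_le_cancel_right)
  qed
  ultimately show "w \<in> (\<lambda>z. z - y) ` L \<Longrightarrow> gradient_restrict h L y \<bullet> w = hform h y [w]"
    and "norm (gradient_restrict h L y) \<le> norm (gradient h y)"
    using G_g gradient_inner(1)[OF assms(3), of w] by (auto simp: V_def)
qed

end

subsection \<open>Isotropic planes\<close>

text \<open>A cubic form is odd, so on the curve through \<open>u\<close> and \<open>v\<close> its
  values at the angles 0 and \<open>pi\<close> are opposite, and the intermediate value theorem
  applies.\<close>

lemma (in smooth_function) cubic_zero_on_plane: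
  assumes "x \<in> A" and "u \<bullet> v = 0" and "u \<noteq> 0" and "v \<noteq> 0"
  obtains s t where "s \<noteq> 0 \<or> t \<noteq> 0"
    "hform h x [s *\<^sub>R u + t *\<^sub>R v, s *\<^sub>R u + t *\<^sub>R v, s *\<^sub>R u + t *\<^sub>R v] = 0"
proof -
  define f where "f = (\<lambda>\<theta>. hform h x [cos \<theta> *\<^sub>R u + sin \<theta> *\<^sub>R v, cos \<theta> *\<^sub>R u + sin \<theta> *\<^sub>R v, cos \<theta> *\<^sub>R u + sin \<theta> *\<^sub>R v])"
  have f: "f \<theta> = cos \<theta> ^ 3 * hform h x [u, u, u] + 3 * cos \<theta> ^ 2 * sin \<theta> * hform h x [u, u, v]
      + 3 * cos \<theta> * sin \<theta> ^ 2 * hform h x [u, v, v] + sin \<theta> ^ 3 * hform h x [v, v, v]" for \<theta>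
    using assms(1) by (simp add: f_def hform_linear hform_sym algebra_simps eval_nat_numeral)
  have "\<exists>\<theta>. f \<theta> = 0"
  proof (cases "f 0 \<le> 0")
    case True
    then have "f 0 \<le> 0" "0 \<le> f pi" by (simp_all add: f)
    moreover have "\<forall>\<theta>. 0 \<le> \<theta> \<and> \<theta> \<le> pi \<longrightarrow> isCont f \<theta>"
      unfolding f[abs_def] by (auto intro!: continuous_intros)
    ultimately show ?thesis using IVT[of f 0 0 pi] by auto
  next
    case False
    then have "f pi \<le> 0" "0 \<le> f 0" by (simp_all add: f)
    moreover have "\<forall>\<theta>. 0 \<le> \<theta> \<and> \<theta> \<le> pi \<longrightarrow> isCont f \<theta>"
      unfolding f[abs_def] by (auto intro!: continuous_intros)
    ultimately show ?thesis using IVT2[of f pi 0 0] by auto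
  qed
  then obtain \<theta> where "f \<theta> = 0" ..
  moreover have "cos \<theta> \<noteq> 0 \<or> sin \<theta> \<noteq> 0"
    using sin_zero_abs_cos_one[of \<theta>] by auto
  ultimately show thesis
    using that[of "cos \<theta>" "sin \<theta>"] by (simp add: f_def)
qed

section \<open>Ranks of column matrices as dimensions; excluding isotropic planes\<close>

lemma rows_eq_image: "rows B = ($) B ` UNIV"
  by (auto simp: rows_def row_def vec_lambda_eta)

lemma rank_transpose_vector_3:
  "rank (transpose (vector [u, v, w] :: real ^ 'n::finite ^ 3)) = dim {u, v, w}"
proof -
  have "rows (vector [u, v, w] :: real ^ 'n ^ 3) = {u, v, w}"
    by (simp add: rows_eq_image UNIV_3)
  then show ?thesis
    unfolding rank_transpose unfolding row_rank_def by simp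
qed

lemma rank_transpose_vector_2:
  "rank (transpose (vector [u, v] :: real ^ 'n::finite ^ 2)) = dim {u, v}"
proof -
  have "rows (vector [u, v] :: real ^ 'n ^ 2) = {u, v}"
    by (simp add: rows_eq_image UNIV_2)
  then show ?thesis
    unfolding rank_transpose unfolding row_rank_def by simp
qed

lemma parallel_if_dim_less_2:
  fixes u v :: "'a::euclidean_space"
  assumes "dim {u, v} < 2" and "v \<noteq> 0"
  obtains \<kappa> where "u = \<kappa> *\<^sub>R v"
proof (cases "u \<in> span {v}")
  case True
  then show thesis using that by (auto simp: span_singleton)
next
  case False
  then have "independent {u, v}" and "u \<noteq> v"
    using assms(2) span_base[of v "{v}"] by (auto simp: independent_insert)
  then have "dim {u, v} = 2"
    by (simp add: dim_eq_card_independent)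
  then show thesis using assms(1) by simp
qed

lemma dim_orthogonal_triple:
  fixes u v w :: "'a::euclidean_space"
  assumes "u \<bullet> v = 0" "u \<bullet> w = 0" "v \<bullet> w = 0" and "u \<noteq> 0" "v \<noteq> 0" "w \<noteq> 0"
  shows "dim {u, v, w} = 3"
proof -
  have "pairwise orthogonal {u, v, w}"
    using assms by (auto simp: pairwise_insert orthogonal_def inner_commute)
  then have "independent {u, v, w}"
    using assms by (intro pairwise_orthogonal_independent) auto
  moreover have "u \<noteq> v" "u \<noteq> w" "v \<noteq> w" using assms by auto
  ultimately show ?thesis by (simp add: dim_eq_card_independent)
qed

text \<open>A binary cubic has a real zero, so an isotropic plane contains a direction \<open>v\<close> as in the third
  condition of the theorem; taking \<open>u\<close> in the plane as well annihilates all terms of the equation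
  there, whatever \<open>w\<close> is.\<close>

lemma (in smooth_function) no_isotropic_plane_of_cond3:
  fixes x :: "real ^ 'n"
  assumes x: "x \<in> A" and dim: "CARD('n) \<ge> 5"
    and cond3: "\<And>v u w. v \<noteq> 0 \<Longrightarrow> hform h x [v] = 0 \<Longrightarrow> hform h x [v, v] = 0 \<Longrightarrow> hform h x [v, v, v] = 0 \<Longrightarrow>
      hform h x [u] = 0 \<Longrightarrow> hform h x [w] = 0 \<Longrightarrow> hform h x [u, v] = 0 \<Longrightarrow> hform h x [w, v] = 0 \<Longrightarrow>
      hform h x [u, u] = 0 \<Longrightarrow> dim {u, v, w} < 3"
    and u: "hform h x [u] = 0" "hform h x [u, u] = 0" and v: "hform h x [v] = 0" "hform h x [v, v] = 0"
    and uv: "hform h x [u, v] = 0" "u \<bullet> v = 0" and "v \<noteq> 0"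
  shows "u = 0"
proof (rule ccontr)
  assume "u \<noteq> 0"
  obtain s t where st: "s \<noteq> 0 \<or> t \<noteq> 0"
    "hform h x [s *\<^sub>R u + t *\<^sub>R v, s *\<^sub>R u + t *\<^sub>R v, s *\<^sub>R u + t *\<^sub>R v] = 0"
    using cubic_zero_on_plane[OF x uv(2) \<open>u \<noteq> 0\<close> \<open>v \<noteq> 0\<close>] .
  define p where "p = s *\<^sub>R u + t *\<^sub>R v"
  \<comment> \<open>The direction of the plane orthogonal to \<open>p\<close>.\<close>
  define q where "q = (- t * (v \<bullet> v)) *\<^sub>R u + (s * (u \<bullet> u)) *\<^sub>R v"
  have pq: "p \<bullet> q = 0"
    using uv(2) by (simp add: p_def q_def inner_add_left inner_add_right inner_diff_right inner_commute)
  have comb: "\<alpha> *\<^sub>R u + \<beta> *\<^sub>R v \<noteq> 0" if "\<alpha> \<noteq> 0 \<or> \<beta> \<noteq> 0" for \<alpha> \<beta>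
  proof
    assume 0: "\<alpha> *\<^sub>R u + \<beta> *\<^sub>R v = 0"
    then have "(\<alpha> *\<^sub>R u + \<beta> *\<^sub>R v) \<bullet> u = 0" "(\<alpha> *\<^sub>R u + \<beta> *\<^sub>R v) \<bullet> v = 0" by simp_all
    then show False
      using that uv(2) \<open>u \<noteq> 0\<close> \<open>v \<noteq> 0\<close> by (simp add: inner_add_left inner_add_right inner_commute)
  qed
  have p: "p \<noteq> 0" and q: "q \<noteq> 0"
    unfolding p_def q_def using st(1) \<open>u \<noteq> 0\<close> \<open>v \<noteq> 0\<close> by (intro comb; auto)+
  have vu: "hform h x [v, u] = 0"
    using uv(1) x by (simp add: hform_swap)
  have lin: "hform h x [\<alpha> *\<^sub>R u + \<beta> *\<^sub>R v] = 0"
    "hform h x [\<alpha> *\<^sub>R u + \<beta> *\<^sub>R v, \<gamma> *\<^sub>R u + \<delta> *\<^sub>R v] = 0" for \<alpha> \<beta> \<gamma> \<delta>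
    using u v uv(1) vu x by (simp_all add: hform_linear)
  \<comment> \<open>\<open>g\<close> and \<open>b\<close> represent the linear forms
    \<open>hform h x [w]\<close> and \<open>hform h x [w, p]\<close> in \<open>w\<close>.
    Orthogonality to \<open>g\<close>, \<open>b\<close>, \<open>p\<close> and \<open>q\<close> is
    four linear conditions, so dimension 5 leaves a nonzero \<open>w\<close>.\<close>
  define g where "g = (\<chi> i. hform h x [axis i 1])"
  define b where "b = (\<chi> i. hform h x [axis i 1, p])"
  have "dim {g, b, p, q} \<le> card {g, b, p, q}"
    by (rule dim_le_card) (simp add: span_superset)+
  also have "\<dots> \<le> 4"
    by (simp add: card_insert_if)
  also have "\<dots> < DIM(real ^ 'n)" using dim by simp
  finally obtain w where w: "w \<noteq> 0" "\<And>y. y \<in> span {g, b, p, q} \<Longrightarrow> orthogonal w y"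
    by (rule orthogonal_to_subspace_exists) blast
  then have orth: "g \<bullet> w = 0" "b \<bullet> w = 0" "p \<bullet> w = 0" "q \<bullet> w = 0"
    using span_base[of _ "{g, b, p, q}"] by (auto simp: orthogonal_def inner_commute)
  have "hform h x [w] = 0" "hform h x [w, p] = 0"
    using hform_inner[of x w "[]"] hform_inner[of x w "[p]"] orth by (simp_all add: g_def b_def)
  \<comment> \<open>In \<open>cond3\<close>, \<open>p\<close> plays the role of \<open>v\<close> and
    \<open>q\<close> that of \<open>u\<close>.\<close>
  then have "dim {q, p, w} < 3"
    using lin st(2) p by (intro cond3) (auto simp: p_def q_def simp del: scaleR_minus_left)
  moreover have "dim {q, p, w} = 3"
    using orth pq p q w(1) by (intro dim_orthogonal_triple) (auto simp: inner_commute)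
  ultimately show False by simp
qed

subsection \<open>Steepness\<close>

context smooth_function
begin

text \<open>A bound on the supremum passes to each infimum, and the gap between \<open>B\<close> and
  \<open>\<epsilon>\<close> yields a point below \<open>\<epsilon>\<close>. For real
  \<open>SUP\<close> and \<open>INF\<close> this requires nonempty spheres and bounded values, which
  the proof supplies first.\<close>

lemma small_gradient_of_SUP_le:
  assumes ball: "cball x \<delta> \<subseteq> A" and \<xi>: "0 < \<xi>" "\<xi> \<le> \<delta>"
    and L: "affine L" "x \<in> L" "aff_dim L > 0"
    and le: "(SUP \<eta>\<in>{0..\<xi>}. INF y\<in>{y \<in> L. norm (x - y) = \<eta>}. norm (gradient_restrict h L y)) \<le> B"
    and "B < \<epsilon>" and \<eta>: "0 \<le> \<eta>" "\<eta> \<le> \<xi>"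
  shows "\<exists>y\<in>(\<lambda>z. z - x) ` L. norm y = \<eta> \<and>
    (\<forall>w\<in>(\<lambda>z. z - x) ` L. \<bar>hform h (x + y) [w]\<bar> \<le> \<epsilon> * norm w)"
proof -
  let ?G = "\<lambda>y. norm (gradient_restrict h L y)"
  let ?S = "\<lambda>\<eta>. {y \<in> L. norm (x - y) = \<eta>}"
  define V where "V = (\<lambda>z. z - x) ` L"
  have V: "subspace V"
    unfolding V_def by (rule affine_diffs_subspace_subtract[OF L(1,2)])
  have mem: "x + w \<in> L \<longleftrightarrow> w \<in> V" for w
    by (force simp: V_def)
  have "dim V > 0"
    using L(3) aff_dim_subspace[OF V] aff_dim_translation_eq_subtract[of x L] by (simp add: V_def)
  then obtain u where u: "u \<in> V" "u \<noteq> 0"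
    by (metis dim_eq_0 not_less_zero singletonI subsetI)
  have nonempty: "?S r \<noteq> {}" if "r \<ge> 0" for r
  proof -
    have "(r / norm u) *\<^sub>R u \<in> V" using V u(1) by (rule subspace_scale)
    then have "x + (r / norm u) *\<^sub>R u \<in> ?S r"
      using u(2) that by (simp add: mem)
    then show ?thesis by blast
  qed
  \<comment> \<open>A gradient bound on the ball bounds the infima from above, as the supremum
    requires.\<close>
  obtain M where M: "M > 0"
    "\<And>z vs. z \<in> cball x \<delta> \<Longrightarrow> length vs = 1 \<Longrightarrow> \<bar>hform h z vs\<bar> \<le> M * prod_list (map norm vs)"
  proof (rule hform_bound[OF compact_cball ball, where k = 1])
    fix M
    assume "M > 0" and
      "\<And>z vs. z \<in> cball x \<delta> \<Longrightarrow> length vs = 1 \<Longrightarrow> \<bar>hform h z vs\<bar> \<le> M * prod_list (map norm vs)"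
    then show thesis by (rule that)
  qed
  have G_le: "?G y \<le> M" if "y \<in> ?S r" "r \<le> \<xi>" for y r
  proof -
    have y: "y \<in> cball x \<delta>" "y \<in> L" using that \<xi> by (auto simp: dist_norm)
    have "y \<in> A" using y(1) ball by blast
    from gradient_inner(1)[OF this, of "gradient h y"]
    have "norm (gradient h y) * norm (gradient h y) = \<bar>hform h y [gradient h y]\<bar>"
      by (metis abs_of_nonneg dot_square_norm power2_eq_square zero_le_power2)
    also have "\<dots> \<le> M * norm (gradient h y)"
      using M(2)[OF y(1), of "[gradient h y]"] by simp
    finally have "norm (gradient h y) \<le> M"
      using M(1) by (cases "gradient h y = 0") auto
    then show ?thesis
      using gradient_restrict_properties(2)[OF L(1) y(2) \<open>y \<in> A\<close>] by linarith
  qed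
  have bdd: "bdd_below (?G ` ?S r)" for r
    by (rule bdd_belowI[of _ 0]) auto
  have "(INF y\<in>?S r. ?G y) \<le> M" if r: "r \<in> {0..\<xi>}" for r
  proof -
    obtain y where y: "y \<in> ?S r" using nonempty[of r] r by auto
    have "(INF y\<in>?S r. ?G y) \<le> ?G y" by (rule cINF_lower[OF bdd y])
    also have "\<dots> \<le> M" using G_le[OF y] r by simp
    finally show ?thesis .
  qed
  then have "bdd_above ((\<lambda>r. INF y\<in>?S r. ?G y) ` {0..\<xi>})"
    by (intro bdd_aboveI[of _ M]) auto
  then have "(INF y\<in>?S \<eta>. ?G y) \<le> (SUP r\<in>{0..\<xi>}. INF y\<in>?S r. ?G y)"
    by (rule cSUP_upper[rotated]) (use \<eta> in simp)
  then have "(INF y\<in>?S \<eta>. ?G y) < \<epsilon>"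
    using le \<open>B < \<epsilon>\<close> by linarith
  then obtain y where y: "y \<in> ?S \<eta>" "?G y < \<epsilon>"
    using cINF_less_iff[OF nonempty[OF \<eta>(1)] bdd] by blast
  have y_A: "y \<in> A" using y(1) \<xi> \<eta> ball by (auto simp: dist_norm)
  have "\<bar>hform h y [w]\<bar> \<le> \<epsilon> * norm w" if w: "w \<in> V" for w
  proof -
    have "y - x \<in> V" using y(1) by (auto simp: V_def)
    with w V have "(y - x) + w \<in> V" by (simp add: subspace_add)
    then have "y + w \<in> L" using mem[of "(y - x) + w"] by simp
    then have "w \<in> (\<lambda>z. z - y) ` L" by (force simp: image_iff)
    then have "gradient_restrict h L y \<bullet> w = hform h y [w]"
      using gradient_restrict_properties(1)[OF L(1) _ y_A] y(1) by blast
    then have "\<bar>hform h y [w]\<bar> \<le> ?G y * norm w"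
      by (metis Cauchy_Schwarz_ineq2)
    also have "\<dots> \<le> \<epsilon> * norm w" using y(2) by (intro mult_right_mono) auto
    finally show ?thesis .
  qed
  moreover have "y - x \<in> V" "norm (y - x) = \<eta>"
    using y(1) by (auto simp: V_def norm_minus_commute)
  ultimately show ?thesis
    unfolding V_def[symmetric] by (intro bexI[of _ "y - x"]) auto
qed

text \<open>One number \<open>r\<close> serves as radius, scale bound and constant. Failure for all
  \<open>r = k n\<close> with \<open>k n\<close> tending to 0 gives a sequence to which
  \<open>small_gradients_jet\<close> applies.\<close>

lemma steepness_inequality:
  fixes I :: "real ^ 'n"
  assumes I: "I \<in> A" and m: "m \<ge> 1"
    and no_plane: "\<And>u v. hform h I [u] = 0 \<Longrightarrow> hform h I [v] = 0 \<Longrightarrow> hform h I [u, u] = 0 \<Longrightarrow>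
      hform h I [u, v] = 0 \<Longrightarrow> hform h I [v, v] = 0 \<Longrightarrow> u \<bullet> v = 0 \<Longrightarrow> v \<noteq> 0 \<Longrightarrow> u = 0"
    and no_jet: "\<And>v a. v \<noteq> 0 \<Longrightarrow> hform h I [v] = 0 \<Longrightarrow> hform h I [v, v] = 0 \<Longrightarrow> hform h I [v, v, v] = 0 \<Longrightarrow>
      hform h I [a] = 0 \<Longrightarrow> hform h I [v, a] = 0 \<Longrightarrow> hform h I [a, a] = - hform h I [v, v, a] / 2 \<Longrightarrow>
      2 * hform h I [a, a] + 2 * hform h I [v, v, a] + hform h I [v, v, v, v] / 6 = 0 \<Longrightarrow>
      5 / 2 * hform h I [v, a, a] + 5 / 6 * hform h I [v, v, v, a] + hform h I [v, v, v, v, v] / 24 = 0 \<Longrightarrow>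
      False"
  shows "\<exists>r>0. \<forall>x\<in>ball I r. cball x r \<subseteq> A \<and>
    (\<forall>L. affine L \<and> aff_dim L = int m \<and> x \<in> L \<and> (\<forall>y\<in>L. (y - x) \<bullet> gradient h x = 0) \<longrightarrow>
      (\<forall>\<xi>\<in>{0<..r}. (SUP \<eta>\<in>{0..\<xi>}. INF y\<in>{y \<in> L. norm (x - y) = \<eta>}. norm (gradient_restrict h L y))
        > r * \<xi> powr 4))"
proof (rule ccontr)
  assume fails: "\<not> ?thesis"
  obtain R where R: "R > 0" "cball I R \<subseteq> A"
    using open_dom I open_contains_cball by blast
  \<comment> \<open>With \<open>k n \<le> R / 2\<close>, the closed ball of radius
    \<open>k n\<close> about any point of \<open>ball I (k n)\<close> lies in
    \<open>cball I R\<close>.\<close>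
  define k where "k = (\<lambda>n. R / 2 / (real n + 1))"
  have k: "k n > 0" "k n \<le> R / 2" for n
    using R(1) by (auto simp: k_def field_simps)
  have k_lim: "k \<longlonglongrightarrow> 0"
    unfolding k_def using LIMSEQ_inverse_real_of_nat[THEN tendsto_mult_right_zero, of "R / 2"]
    by (simp add: field_simps)
  have sub: "cball x (k n) \<subseteq> A" if "x \<in> ball I (k n)" for x n
  proof -
    have "cball x (k n) \<subseteq> cball I R"
    proof
      fix y assume "y \<in> cball x (k n)"
      then have "dist I y \<le> k n + k n"
        using that dist_triangle[of I y x] by simp
      then show "y \<in> cball I R" using k(2)[of n] by simp
    qed
    then show ?thesis using R(2) by blast
  qed
  define violates where "violates = (\<lambda>r x L \<xi>. x \<in> ball I r \<and> affine L \<and> aff_dim L = int m \<and> x \<in> L \<and>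
      (\<forall>y\<in>L. (y - x) \<bullet> gradient h x = 0) \<and> 0 < \<xi> \<and> \<xi> \<le> r \<and>
      (SUP \<eta>\<in>{0..\<xi>}. INF y\<in>{y \<in> L. norm (x - y) = \<eta>}. norm (gradient_restrict h L y)) \<le> r * \<xi> powr 4)"
  have "\<exists>x L \<xi>. violates (k n) x L \<xi>" for n
  proof (rule ccontr)
    assume none: "\<not> ?thesis"
    have "(SUP \<eta>\<in>{0..\<xi>}. INF y\<in>{y \<in> L. norm (x - y) = \<eta>}. norm (gradient_restrict h L y)) > k n * \<xi> powr 4"
      if "x \<in> ball I (k n)" "affine L \<and> aff_dim L = int m \<and> x \<in> L \<and> (\<forall>y\<in>L. (y - x) \<bullet> gradient h x = 0)"
        "\<xi> \<in> {0<..k n}" for x L \<xi>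
    proof (rule ccontr)
      assume "\<not> ?thesis"
      then have "violates (k n) x L \<xi>"
        unfolding violates_def not_less using that by simp
      with none show False by blast
    qed
    with fails k(1) sub show False by blast
  qed
  then obtain x L \<xi> where viol: "\<And>n. violates (k n) (x n) (L n) (\<xi> n)"
    by metis
  have x: "x n \<in> ball I (k n)"
    and L: "affine (L n)" "aff_dim (L n) = int m" "x n \<in> L n"
      "\<And>y. y \<in> L n \<Longrightarrow> (y - x n) \<bullet> gradient h (x n) = 0"
    and \<xi>: "0 < \<xi> n" "\<xi> n \<le> k n"
    and SUP: "(SUP \<eta>\<in>{0..\<xi> n}. INF y\<in>{y \<in> L n. norm (x n - y) = \<eta>}. norm (gradient_restrict h (L n) y))
      \<le> k n * \<xi> n powr 4" for n
    using viol[of n] by (simp_all only: violates_def)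
  have x_A: "x n \<in> A" for n
    using sub[OF x] k(1)[of n] by (meson centre_in_cball less_imp_le subsetD)
  \<comment> \<open>The summand \<open>\<xi> n ^ 5\<close> makes the bound strict and is negligible
    against \<open>\<xi> n ^ 4\<close>.\<close>
  define e where "e = (\<lambda>n. k n * \<xi> n powr 4 + \<xi> n ^ 5)"
  have "\<xi> n powr 4 = \<xi> n ^ 4" for n
    using \<xi>(1)[of n] by simp
  then have e_div: "e n / \<xi> n ^ 4 = k n + \<xi> n" for n
    using \<xi>(1)[of n] by (simp add: e_def add_divide_distrib eval_nat_numeral)
  have \<xi>_lim: "\<xi> \<longlonglongrightarrow> 0"
  proof (rule tendsto_sandwich[OF _ _ tendsto_const k_lim])
    show "\<forall>\<^sub>F n in sequentially. 0 \<le> \<xi> n"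
      by (intro always_eventually allI less_imp_le \<xi>(1))
    show "\<forall>\<^sub>F n in sequentially. \<xi> n \<le> k n"
      by (intro always_eventually allI \<xi>(2))
  qed
  have "dist (x n) I \<le> k n" for n
    using x[of n] by (simp add: dist_commute)
  then have "(\<lambda>n. dist (x n) I) \<longlonglongrightarrow> 0"
    by (intro Lim_null_comparison[OF _ k_lim] always_eventually allI) simp
  then have x_lim: "x \<longlonglongrightarrow> I" by (rule tendsto_dist_iff[THEN iffD2])
  show False
  proof (rule small_gradients_jet[where I = I and R = R and x = x and \<xi> = \<xi> and e = e
        and V = "\<lambda>n. (\<lambda>z. z - x n) ` L n"])
    show "norm (x n - I) + \<xi> n \<le> R" for n
      using x[of n] \<xi>(2)[of n] k(2)[of n] by (simp add: dist_norm norm_minus_commute)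
    show "(\<lambda>n. e n / \<xi> n ^ 4) \<longlonglongrightarrow> 0"
      unfolding e_div using tendsto_add[OF k_lim \<xi>_lim] by simp
    show "hform h (x n) [w] = 0" if "w \<in> (\<lambda>z. z - x n) ` L n" for n w
      using that L(4) gradient_inner(1)[OF x_A, of n w] by (auto simp: inner_commute)
    show "subspace ((\<lambda>z. z - x n) ` L n)" for n
      by (rule affine_diffs_subspace_subtract[OF L(1,3)])
    show "\<exists>y\<in>(\<lambda>z. z - x n) ` L n. norm y = \<eta> \<and>
        (\<forall>w\<in>(\<lambda>z. z - x n) ` L n. \<bar>hform h (x n + y) [w]\<bar> \<le> e n * norm w)"
      if "0 \<le> \<eta>" "\<eta> \<le> \<xi> n" for n \<eta>
      by (rule small_gradient_of_SUP_le[OF sub[OF x] \<xi>(1,2) L(1,3) _ SUP _ that])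
        (use L(2)[of n] m \<xi>(1)[of n] in \<open>auto simp: e_def\<close>)
    show "u = 0" if "hform h I [u] = 0" "hform h I [v] = 0" "hform h I [u, u] = 0"
      "hform h I [u, v] = 0" "hform h I [v, v] = 0" "u \<bullet> v = 0" "v \<noteq> 0" for u v
      using that by (rule no_plane)
  qed (fact R(2) x_lim \<xi>(1) \<xi>_lim | erule (8) no_jet)+
qed

end

theorem theorem6:
  fixes A :: "(real ^ 5) set" and h :: "real ^ 5 \<Rightarrow> real" and I :: "real ^ 5"
  assumes "open A" and "smooth_on A h" and "I \<in> A" and "gradient h I \<noteq> 0"
    and four_jet_nondegenerate:
      "\<forall>v. hform h I [v] = 0 \<and> hform h I [v, v] = 0 \<and> hform h I [v, v, v] = 0 \<and>
           hform h I [v, v, v, v] = 0 \<longrightarrow> v = 0"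
    and cond2:
      "\<forall>v. v \<noteq> 0 \<and> hform h I [v] = 0 \<and> hform h I [v, v] = 0 \<and> hform h I [v, v, v] = 0 \<longrightarrow>
         (\<forall>u. hform h I [u] = 0 \<and> hform h I [u, v] = 0 \<and>
            hform h I [u, u] * hform h I [v, v, v, v] = 3 * (hform h I [v, v, u])\<^sup>2 \<and>
            15 * (hform h I [v, v, u])\<^sup>2 * hform h I [u, u, v]
              + hform h I [v, v, v, v, v] * (hform h I [u, u])\<^sup>2
              = 10 * hform h I [v, v, v, u] * hform h I [u, v, v] * hform h I [u, u]
            \<longrightarrow> rank (transpose (vector [u, v] :: real ^ 5 ^ 2)) < 2)"
    and cond3:
      "\<forall>v. v \<noteq> 0 \<and> hform h I [v] = 0 \<and> hform h I [v, v] = 0 \<and> hform h I [v, v, v] = 0 \<longrightarrow>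
         (\<forall>u w. hform h I [u] = 0 \<and> hform h I [w] = 0 \<and>
            hform h I [u, v] = 0 \<and> hform h I [w, v] = 0 \<and>
            (hform h I [v, v, v, v] * hform h I [u, u] - 6 * (hform h I [u, v, v])\<^sup>2)
              * (hform h I [w, w] * hform h I [u, u] - (hform h I [u, w])\<^sup>2)
            + 12 * hform h I [u, v, v] * hform h I [v, v, w] * hform h I [u, u] * hform h I [u, w]
            - 6 * (hform h I [u, v, v])\<^sup>2 * (hform h I [u, w])\<^sup>2
            - 6 * (hform h I [v, v, w])\<^sup>2 * (hform h I [u, u])\<^sup>2 = 0
            \<longrightarrow> rank (transpose (vector [u, v, w] :: real ^ 5 ^ 3)) < 3)"
    and cond4:
      "\<forall>v. v \<noteq> 0 \<and> hform h I [v] = 0 \<and> hform h I [v, v] = 0 \<longrightarrow>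
         (\<forall>u w x. hform h I [u] = 0 \<and> hform h I [w] = 0 \<and> hform h I [x] = 0 \<and>
            hform h I [u, v] = 0 \<and> hform h I [w, v] = 0 \<and> hform h I [x, v] = 0
            \<longrightarrow> rank (transpose (vector [u, w, x, v] :: real ^ 5 ^ 4)) < 4)"
  shows "\<exists>U. open U \<and> I \<in> U \<and> U \<subseteq> A \<and> steep_on A h U"
proof -
  interpret smooth_function A h
    using \<open>open A\<close> \<open>smooth_on A h\<close> by unfold_locales
  have no_plane: "u = 0" if "hform h I [u] = 0" "hform h I [v] = 0" "hform h I [u, u] = 0"
    "hform h I [u, v] = 0" "hform h I [v, v] = 0" "u \<bullet> v = 0" "v \<noteq> 0" for u v
  proof (rule no_isotropic_plane_of_cond3[OF \<open>I \<in> A\<close>, of u v])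
    fix v u w
    assume v: "v \<noteq> 0" "hform h I [v] = 0" "hform h I [v, v] = 0" "hform h I [v, v, v] = 0"
      and "hform h I [u] = 0" "hform h I [w] = 0" "hform h I [u, v] = 0" "hform h I [w, v] = 0"
      and "hform h I [u, u] = 0"
    \<comment> \<open>With \<open>hform h I [u, u] = 0\<close> the product of the two brackets
      becomes \<open>6 * (hform h I [u, v, v])\<^sup>2 * (hform h I [u, w])\<^sup>2\<close>, which a
      later term of the equation cancels.\<close>
    then have "rank (transpose (vector [u, v, w] :: real ^ 5 ^ 3)) < 3"
      using cond3[rule_format, of v u w] by (simp add: algebra_simps)
    then show "dim {u, v, w} < 3"
      by (simp only: rank_transpose_vector_3)
  qed (use that in auto)
  have no_jet: False
    if v: "v \<noteq> 0" "hform h I [v] = 0" "hform h I [v, v] = 0" "hform h I [v, v, v] = 0"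
      and a: "hform h I [a] = 0" "hform h I [v, a] = 0" "hform h I [a, a] = - hform h I [v, v, a] / 2"
      and 4: "2 * hform h I [a, a] + 2 * hform h I [v, v, a] + hform h I [v, v, v, v] / 6 = 0"
      and 5: "5 / 2 * hform h I [v, a, a] + 5 / 6 * hform h I [v, v, v, a]
        + hform h I [v, v, v, v, v] / 24 = 0" for v a
  proof -
    \<comment> \<open>In terms of \<open>b\<close> the limiting identities express the forms
      \<open>[v, v, a]\<close>, \<open>[v, v, v, v]\<close> and \<open>[v, v, v, v, v]\<close>;
      substitution turns both nonlinear equations of \<open>cond2\<close> into identities.\<close>
    define b where "b = hform h I [a, a]"
    have av: "hform h I [a, v] = 0" "hform h I [a, a, v] = hform h I [v, a, a]"
      "hform h I [a, v, v] = hform h I [v, v, a]"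
      using a(2) \<open>I \<in> A\<close> by (simp_all add: hform_sym)
    have vva: "hform h I [v, v, a] = - 2 * b" and v4: "hform h I [v, v, v, v] = 12 * b"
      and v5: "hform h I [v, v, v, v, v] = - 60 * hform h I [v, a, a] - 20 * hform h I [v, v, v, a]"
      using a(3) 4 5 by (simp_all add: b_def)
    have "rank (transpose (vector [a, v] :: real ^ 5 ^ 2)) < 2"
    proof (rule cond2[rule_format, of v a]; intro conjI)
      show "hform h I [a, a] * hform h I [v, v, v, v] = 3 * (hform h I [v, v, a])\<^sup>2"
        by (simp add: vva v4 power2_eq_square flip: b_def)
      show "15 * (hform h I [v, v, a])\<^sup>2 * hform h I [a, a, v] + hform h I [v, v, v, v, v] * (hform h I [a, a])\<^sup>2
          = 10 * hform h I [v, v, v, a] * hform h I [a, v, v] * hform h I [a, a]"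
        unfolding av vva v5 b_def[symmetric] by (simp add: power2_eq_square algebra_simps)
    qed (use v a av in auto)
    then have "dim {a, v} < 2"
      by (simp only: rank_transpose_vector_2)
    then obtain \<kappa> where "a = \<kappa> *\<^sub>R v"
      using parallel_if_dim_less_2 v(1) by blast
    \<comment> \<open>If \<open>a\<close> is a multiple of \<open>v\<close>, then \<open>b\<close>
      is a multiple of \<open>hform h I [v, v]\<close>, which vanishes; so the fourth-order form
      \<open>12 * b\<close> vanishes too.\<close>
    then have "b = 0"
      using v(3) \<open>I \<in> A\<close> by (simp add: b_def hform_linear)
    then have "v = 0"
      using four_jet_nondegenerate v v4 by simp
    with v(1) show False by blast
  qed
  have "\<forall>\<^sub>F x in nhds I. x \<in> A \<and> gradient h x \<noteq> 0"
  proof -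
    \<comment> \<open>Derivatives in the fixed direction \<open>gradient h I\<close> are continuous
      in the base point, so they and the gradient stay nonzero near \<open>I\<close>.\<close>
    have "hform h I [gradient h I] \<noteq> 0"
      using gradient_inner(1)[OF \<open>I \<in> A\<close>, of "gradient h I"] \<open>gradient h I \<noteq> 0\<close> by (metis inner_eq_zero_iff)
    with isCont_hform[OF \<open>I \<in> A\<close>, of "[gradient h I]", unfolded isCont_def,
        THEN tendsto_at_iff_tendsto_nhds[THEN iffD1]]
    have "\<forall>\<^sub>F x in nhds I. hform h x [gradient h I] \<noteq> 0"
      by (rule tendsto_imp_eventually_ne)
    moreover have "\<forall>\<^sub>F x in nhds I. x \<in> A"
      using \<open>open A\<close> \<open>I \<in> A\<close> by (rule eventually_nhds_in_open)
    ultimately show ?thesis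
    proof eventually_elim
      case (elim x)
      then show ?case using gradient_inner(1)[of x "gradient h I"] by auto
    qed
  qed
  then obtain r0 where r0: "r0 > 0" "\<And>x. dist x I < r0 \<Longrightarrow> x \<in> A \<and> gradient h x \<noteq> 0"
    unfolding eventually_nhds_metric by blast
  define steep where "steep = (\<lambda>m r x. cball x r \<subseteq> A \<and>
    (\<forall>L. affine L \<and> aff_dim L = int m \<and> x \<in> L \<and> (\<forall>y\<in>L. (y - x) \<bullet> gradient h x = 0) \<longrightarrow>
      (\<forall>\<xi>\<in>{0<..r}. (SUP \<eta>\<in>{0..\<xi>}. INF y\<in>{y \<in> L. norm (x - y) = \<eta>}. norm (gradient_restrict h L y))
        > r * \<xi> powr 4)))"
  have "\<exists>r>0. \<forall>x\<in>ball I r. steep m r x" if "m \<ge> 1" for m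
    unfolding steep_def by (rule steepness_inequality[OF \<open>I \<in> A\<close> that no_plane no_jet])
  then obtain r where r: "\<And>m. m \<ge> 1 \<Longrightarrow> r m > 0" "\<And>m x. m \<ge> 1 \<Longrightarrow> x \<in> ball I (r m) \<Longrightarrow> steep m (r m) x"
    by metis
  \<comment> \<open>The constants may depend on \<open>m\<close>; only the ball of base points must
    be common to the finitely many \<open>m\<close>.\<close>
  define \<rho> where "\<rho> = Min (insert r0 (r ` {1..<DIM(real ^ 5)}))"
  have \<rho>: "\<rho> > 0" "\<rho> \<le> r0" "\<And>m. m \<in> {1..<DIM(real ^ 5)} \<Longrightarrow> \<rho> \<le> r m"
  proof -
    have fin: "finite (insert r0 (r ` {1..<DIM(real ^ 5)}))" by simp
    show "\<rho> > 0"
      unfolding \<rho>_def using r0(1) r(1) by (subst Min_gr_iff[OF fin]) auto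
    show "\<rho> \<le> r0" "\<And>m. m \<in> {1..<DIM(real ^ 5)} \<Longrightarrow> \<rho> \<le> r m"
      unfolding \<rho>_def by (rule Min_le[OF fin], blast)+
  qed
  have "steep_on A h (ball I \<rho>)"
    unfolding steep_on_def
  proof (intro conjI ballI)
    show "gradient h x \<noteq> 0" if "x \<in> ball I \<rho>" for x
      using r0(2)[of x] that \<rho>(2) by (simp add: dist_commute)
    fix m
    assume m: "m \<in> {1..<DIM(real ^ 5)}"
    have "ball I \<rho> \<subseteq> ball I (r m)"
      using \<rho>(3)[OF m] by (rule subset_ball)
    then have steep: "r m > 0" "\<forall>x\<in>ball I \<rho>. steep m (r m) x"
      using r[of m] m by auto
    show "\<exists>C>0. \<exists>\<delta>>0. \<exists>\<alpha>>1. \<forall>x\<in>ball I \<rho>. cball x \<delta> \<subseteq> A \<and>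
        (\<forall>L. affine L \<and> aff_dim L = int m \<and> x \<in> L \<and> (\<forall>y\<in>L. (y - x) \<bullet> gradient h x = 0) \<longrightarrow>
          (\<forall>\<xi>\<in>{0<..\<delta>}. (SUP \<eta>\<in>{0..\<xi>}. INF y\<in>{y \<in> L. norm (x - y) = \<eta>}. norm (gradient_restrict h L y))
            > C * \<xi> powr \<alpha>))"
      \<comment> \<open>Both coefficients are \<open>r m\<close>, and the index is 4 for every
        \<open>m\<close>.\<close>
      by (rule exI[of _ "r m"], rule conjI[OF steep(1)], rule exI[of _ "r m"], rule conjI[OF steep(1)],
          rule exI[of _ 4], rule conjI[OF _ steep(2)[unfolded steep_def]]) simp
  qed
  moreover have "ball I \<rho> \<subseteq> A"
  proof
    fix x
    assume "x \<in> ball I \<rho>"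
    then show "x \<in> A" using r0(2)[of x] \<rho>(2) by (simp add: dist_commute)
  qed
  ultimately show ?thesis
    using \<rho>(1) by (intro exI[of _ "ball I \<rho>"]) auto
qed

end
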